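(* Fix $N\ge1$, $0<\mathsf{a}<1$ and $c_1,c_2>0$ such that $\mathsf{a}c_1<1$. Let $0<t_1\le t_2\le\dots\le t_N$ be such that $\mathsf{a}t_N<1$ and $\mathsf{a}t_N^2c_2<1$. Then $$\mathcal{G}_N^{(\mathsf{a},c_1,c_2)}(t_1,\dots,t_N)=\pi^{t_1,\dots,t_N}\left[\bigotimes_{j=1}^N\frac{1}{\mathfrak{h}_{\mathsf{a}t_j}}\right].$$
   Context: **Generating function.** For $(m_1,\dots,m_N),(n_1,\dots,n_N)\in\mathbb{Z}_{\ge0}^N$ let $\mathbf{L}_1(j)=\sum_{k=1}^j m_k$, $\mathbf{L}_2(j)=\sum_{k=1}^j n_k$, $\mathbf{L}_1(0)=\mathbf{L}_2(0)=0$, and $$\mathbb{Q}_N^{(\mathsf{a},c_1,c_2)}(\mathbf{L}_1,\mathbf{L}_2)=\mathsf{a}^{\mathbf{L}_1(N)}\mathsf{a}^{\mathbf{L}_2(N)}(c_1c_2)^{\max_{1\le j\le N}(\mathbf{L}_2(j)-\mathbf{L}_1(j-1))}\,c_2^{\mathbf{L}_1(N)-\mathbf{L}_2(N)} .$$ Then $$\mathcal{G}_N^{(\mathsf{a},c_1,c_2)}(t_1,\dots,t_N)=\sum_{\mathbf{L}_1,\mathbf{L}_2}\ \prod_{j=1}^N t_j^{2(\mathbf{L}_1(j)-\mathbf{L}_1(j-1))}\ \mathbb{Q}_N^{(\mathsf{a},c_1,c_2)}(\mathbf{L}_1,\mathbf{L}_2),$$ the sum being over all such pairs. **Functionals.**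 Write $\mathfrak{h}_\alpha(y)=1+\alpha^2-\alpha y$. For $0<\rho<1$ let $D_\rho=\{w+1/w:\rho<|w|\le1\}$, the open set enclosed by the ellipse $\{w+1/w:|w|=\rho\}$, and $\bar D_\rho$ its closure; $\bar D_1=[-2,2]$. For $0<r\le1$, $\mathcal{A}_r$ is the set of functions $f:\bar D_r\to\mathbb{C}$ that extend analytically to $D_{\rho'}$ for some $0<\rho'<r$ ($\rho'$ may depend on $f$); functions analytic on a larger domain are regarded as elements of $\mathcal{A}_r$ by restriction. For $a,b,c\in\mathbb{C}$ let $R=\max\{1,|a|,|b|,|c|\}$; for $f\in\mathcal{A}_{1/R}$ the free Askey–Wilson functional is $$\mathbb{L}^{(a,b,c)}[f]=\frac{1}{2\pi i}\oint_{|w|=\rho}\frac{f(w+\frac1w)(1-w^2)(1-abcw)}{w(1-aw)(1-bw)(1-cw)}\,dw,$$ with the circle counterclockwise and any $\rho\in(\rho',1/R)$ (the value does not depend on the choice). Also $\mathbb{L}^{(a,b)}=\mathbb{L}^{(a,b,0)}$. For $x\in\mathbb{C}$ let $\mathfrak{u}(x)$ be the solution of $\mathfrak{u}+1/\mathfrak{u}=x$ with $|\mathfrak{u}|<1$ if $x\notin[-2,2]$, and $\mathfrak{u}(2\cos\theta)=e^{i\theta}$ for $0\le\theta\le\pi$. With $c_1,c_2$ fixed and $0<s\le t$ set $$\pi^{t}=\mathbb{L}^{(c_2t,\,c_1/t)},\qquad P_x^{s,t}=\mathbb{L}^{(c_2t,\ s\,\mathfrak{u}(x)/t,\ s/(t\,\mathfrak{u}(x)))}.$$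 For $0<t_1\le\dots\le t_d$ and functions $f_j$ analytic on $D_{\mathsf{a}t_j}$, writing $(f_1\otimes\dots\otimes f_d)(x_1,\dots,x_d)=\prod_j f_j(x_j)$, the functional $\pi^{t_1,\dots,t_d}$ is defined recursively: for $d=1$ it is $\pi^{t_1}$, and for $d\ge2$ $$\pi^{t_1,\dots,t_d}\Big[\bigotimes_{j=1}^d f_j\Big]=\pi^{t_1,\dots,t_{d-1}}\Big[\Big(\bigotimes_{j=1}^{d-2}f_j\Big)\otimes\tilde f_{d-1}\Big],\qquad \tilde f_{d-1}(x)=f_{d-1}(x)\,P_x^{t_{d-1},t_d}[f_d],\ x\in D_{\mathsf{a}t_{d-1}}.$$ *)

theory Defs
  imports "HOL-Complex_Analysis.Complex_Analysis"
begin

section \<open>Generating function\<close>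

definition height :: "(nat \<Rightarrow> nat) \<Rightarrow> nat \<Rightarrow> nat" where
  "height m j = (\<Sum>k=1..j. m k)"

text \<open>The exponents of \<open>c1 * c2\<close> and \<open>c2\<close> are integers, the second one possibly negative.\<close>

definition two_layer_weight ::
    "nat \<Rightarrow> real \<Rightarrow> real \<Rightarrow> real \<Rightarrow> (nat \<Rightarrow> nat) \<Rightarrow> (nat \<Rightarrow> nat) \<Rightarrow> real" where
  "two_layer_weight N a c1 c2 L1 L2 =
     a ^ L1 N * a ^ L2 N
     * (c1 * c2) powi (Max ((\<lambda>j. int (L2 j) - int (L1 (j - 1))) ` {1..N}))
     * c2 powi (int (L1 N) - int (L2 N))"

definition gen_fun_term ::
    "nat \<Rightarrow> real \<Rightarrow> real \<Rightarrow> real \<Rightarrow> (nat \<Rightarrow> real) \<Rightarrow> (nat \<Rightarrow> nat) \<times> (nat \<Rightarrow> nat) \<Rightarrow> real" where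
  "gen_fun_term N a c1 c2 t = (\<lambda>(m, n).
     (\<Prod>j=1..N. t j ^ (2 * (height m j - height m (j - 1))))
     * two_layer_weight N a c1 c2 (height m) (height n))"

text \<open>A pair of paths is indexed by its increments \<open>(m\<^sub>1,\<dots>,m\<^sub>N)\<close>, \<open>(n\<^sub>1,\<dots>,n\<^sub>N)\<close>; extensional
  functions on \<open>{1..N}\<close> make this indexing one-to-one.\<close>

definition increment_pairs :: "nat \<Rightarrow> ((nat \<Rightarrow> nat) \<times> (nat \<Rightarrow> nat)) set" where
  "increment_pairs N = ({1..N} \<rightarrow>\<^sub>E UNIV) \<times> ({1..N} \<rightarrow>\<^sub>E UNIV)"

definition gen_fun :: "nat \<Rightarrow> real \<Rightarrow> real \<Rightarrow> real \<Rightarrow> (nat \<Rightarrow> real) \<Rightarrow> real" where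
  "gen_fun N a c1 c2 t = infsum (gen_fun_term N a c1 c2 t) (increment_pairs N)"

section \<open>Free Askey--Wilson functionals\<close>

definition frak_h :: "complex \<Rightarrow> complex \<Rightarrow> complex" where
  "frak_h \<alpha> y = 1 + \<alpha>\<^sup>2 - \<alpha> * y"

definition ellipse_dom :: "real \<Rightarrow> complex set" where
  "ellipse_dom \<rho> = {w + 1 / w | w. \<rho> < norm w \<and> norm w \<le> 1}"

text \<open>The formula for \<^const>\<open>ellipse_dom\<close> gives the empty set at \<open>\<rho> = 1\<close>, whereas the closed
  domain degenerates there to the segment \<open>[-2, 2]\<close>.\<close>

definition ellipse_cdom :: "real \<Rightarrow> complex set" where
  "ellipse_cdom r = (if r = 1 then complex_of_real ` {-2..2} else closure (ellipse_dom r))"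

text \<open>A function on \<open>ellipse_cdom r\<close> is represented by a total function whose other values are
  irrelevant. It lies in the class \<open>\<A>\<^sub>r\<close> iff it has an analytic extension \<open>g\<close> in the following
  sense.\<close>

definition analytic_ext ::
    "real \<Rightarrow> (complex \<Rightarrow> complex) \<Rightarrow> real \<Rightarrow> (complex \<Rightarrow> complex) \<Rightarrow> bool" where
  "analytic_ext r f \<rho>' g \<longleftrightarrow>
     0 < \<rho>' \<and> \<rho>' < r \<and> g analytic_on ellipse_dom \<rho>' \<and> (\<forall>x\<in>ellipse_cdom r. g x = f x)"

definition AW_integral ::
    "complex \<Rightarrow> complex \<Rightarrow> complex \<Rightarrow> (complex \<Rightarrow> complex) \<Rightarrow> real \<Rightarrow> complex" where
  "AW_integral a b c g \<rho> =
     1 / (2 * of_real pi * \<i>) * contour_integral (circlepath 0 \<rho>)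
       (\<lambda>w. g (w + 1 / w) * (1 - w\<^sup>2) * (1 - a * b * c * w)
             / (w * (1 - a * w) * (1 - b * w) * (1 - c * w)))"

definition AW_radius :: "complex \<Rightarrow> complex \<Rightarrow> complex \<Rightarrow> real" where
  "AW_radius a b c = Max {1, norm a, norm b, norm c}"

text \<open>The value does not depend on the extension \<open>g\<close>, on \<open>\<rho>'\<close>, or on the radius \<open>\<rho>\<close>.\<close>

definition AW_functional ::
    "complex \<Rightarrow> complex \<Rightarrow> complex \<Rightarrow> (complex \<Rightarrow> complex) \<Rightarrow> complex" where
  "AW_functional a b c f =
     (THE v. \<exists>\<rho>' g. analytic_ext (1 / AW_radius a b c) f \<rho>' g \<and>
        (\<forall>\<rho>\<in>{\<rho>'<..<1 / AW_radius a b c}. v = AW_integral a b c g \<rho>))"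

definition frak_u :: "complex \<Rightarrow> complex" where
  "frak_u x =
     (if x \<in> complex_of_real ` {-2..2}
      then (THE u. \<exists>\<theta>\<in>{0..pi}. x = of_real (2 * cos \<theta>) \<and> u = exp (\<i> * of_real \<theta>))
      else (THE u. u \<noteq> 0 \<and> u + 1 / u = x \<and> norm u < 1))"

definition AW_marginal :: "real \<Rightarrow> real \<Rightarrow> real \<Rightarrow> (complex \<Rightarrow> complex) \<Rightarrow> complex" where
  "AW_marginal c1 c2 t = AW_functional (of_real (c2 * t)) (of_real (c1 / t)) 0"

definition AW_transition ::
    "real \<Rightarrow> real \<Rightarrow> real \<Rightarrow> complex \<Rightarrow> (complex \<Rightarrow> complex) \<Rightarrow> complex" where
  "AW_transition c2 s t x =
     AW_functional (of_real (c2 * t))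
       (of_real s * frak_u x / of_real t) (of_real s / (of_real t * frak_u x))"

text \<open>\<open>AW_joint c1 c2 t d f\<close> is the functional with times \<open>t 1, \<dots>, t d\<close> applied to the tensor
  product of \<open>f 1, \<dots>, f d\<close>; no value is specified for \<open>d = 0\<close>.\<close>

fun AW_joint ::
    "real \<Rightarrow> real \<Rightarrow> (nat \<Rightarrow> real) \<Rightarrow> nat \<Rightarrow> (nat \<Rightarrow> complex \<Rightarrow> complex) \<Rightarrow> complex" where
  "AW_joint c1 c2 t (Suc 0) f = AW_marginal c1 c2 (t 1) (f 1)"
| "AW_joint c1 c2 t (Suc (Suc d)) f =
     AW_joint c1 c2 t (Suc d)
       (f(Suc d := (\<lambda>x. f (Suc d) x *
            AW_transition c2 (t (Suc d)) (t (Suc (Suc d))) x (f (Suc (Suc d))))))"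

end

theory Submission
  imports Defs
begin

text \<open>
  Read the two paths from step \<open>N\<close> down to step \<open>1\<close>. The maximum in the exponent of \<open>c1 * c2\<close> then
  follows a Lindley recursion: a state \<open>E\<close> becomes \<open>n\<^sub>j + max 0 (E - m\<^sub>j)\<close> at step \<open>j\<close>, with weight
  \<open>(a t\<^sub>j\<^sup>2)^m\<^sub>j a^n\<^sub>j c2^(max 0 (m\<^sub>j - E))\<close> and terminal weight \<open>c1 ^ E\<close>. So the generating function is
  the value at the state \<open>0\<close> of an iterated transfer operator \<open>W \<mapsto> W'\<close>, and for
  \<open>H y = (\<Sum>E. W E * y ^ E)\<close>, with \<open>\<beta> = a s\<^sup>2\<close>,
  \<open>(y - a) (1 - \<beta> y) H' y = y H y - H a * a (1 - c2 s\<^sup>2 y) / (1 - \<beta> c2)\<close>.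

  On the analytic side, the functional at the times \<open>t\<^sub>1, \<dots>, t\<^sub>d\<close> with \<open>1 / h\<close> in the first \<open>d - 1\<close>
  slots and any analytic \<open>g\<close> in the last one is the contour integral of
  \<open>g (w + 1/w) (1 - w\<^sup>2) / (w (1 - c2 t\<^sub>d w)) H (w / t\<^sub>d)\<close>, where \<open>H\<close> belongs to \<open>d - 1\<close> transfer steps.
  To pass from \<open>d\<close> to \<open>d + 1\<close>, exchange the two contour integrals; the inner one has exactly two poles,
  at \<open>a t\<^sub>d\<close> and at \<open>t\<^sub>d v / t\<^sub>d\<^sub>+\<^sub>1\<close>, and its residues give the functional equation above.
\<close>

section \<open>Transfer operator of the two-layer weights\<close>

text \<open>The increment of the second path summed out, where \<open>e\<close> is the part of the
  state that the increment of the first path leaves over.\<close>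

definition geo_tail :: "real \<Rightarrow> (nat \<Rightarrow> real) \<Rightarrow> nat \<Rightarrow> real" where
  "geo_tail a W e = (\<Sum>q. a ^ q * W (q + e))"

text \<open>One step of the transfer operator; its explicit form as a double series over the two increments
  is \<open>layer_step_has_sum\<close> below.\<close>

fun layer_step :: "real \<Rightarrow> real \<Rightarrow> real \<Rightarrow> (nat \<Rightarrow> real) \<Rightarrow> nat \<Rightarrow> real" where
  "layer_step a c2 \<beta> W 0 = geo_tail a W 0 / (1 - \<beta> * c2)"
| "layer_step a c2 \<beta> W (Suc E) = geo_tail a W (Suc E) + \<beta> * layer_step a c2 \<beta> W E"

primrec layer_weight :: "real \<Rightarrow> real \<Rightarrow> real \<Rightarrow> (nat \<Rightarrow> real) \<Rightarrow> nat \<Rightarrow> nat \<Rightarrow> real" where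
  "layer_weight a c1 c2 t 0 = (\<lambda>E. c1 ^ E)"
| "layer_weight a c1 c2 t (Suc d) =
     layer_step a c2 (a * (t (Suc d))\<^sup>2) (layer_weight a c1 c2 t d)"

text \<open>One rate \<open>q\<close> serves every step: \<open>a * q < 1\<close> makes the tails
  converge, and \<open>\<beta> < q\<close> lets the bound survive the recursion of
  \<open>layer_step\<close>.\<close>

definition geo_bounded :: "real \<Rightarrow> (nat \<Rightarrow> real) \<Rightarrow> bool" where
  "geo_bounded q W \<longleftrightarrow> (\<exists>C\<ge>0. \<forall>n. 0 \<le> W n \<and> W n \<le> C * q ^ n)"

lemma geo_bounded_nonneg: "geo_bounded q W \<Longrightarrow> 0 \<le> W n"
  by (auto simp: geo_bounded_def)

lemma geo_bounded_summable:
  assumes "geo_bounded q W" "0 \<le> a" "0 < q" "a * q < 1"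
  shows "summable (\<lambda>j. a ^ j * W (j + e))"
proof -
  obtain C where C: "C \<ge> 0" "\<And>n. 0 \<le> W n" "\<And>n. W n \<le> C * q ^ n"
    using assms(1) by (auto simp: geo_bounded_def)
  show ?thesis
  proof (rule summable_comparison_test')
    show "summable (\<lambda>j. C * q ^ e * (a * q) ^ j)"
      by (intro summable_mult summable_geometric) (use assms in auto)
    show "norm (a ^ j * W (j + e)) \<le> C * q ^ e * (a * q) ^ j" for j
      using mult_left_mono[OF C(3)[of "j + e"], of "a ^ j"] C(2) assms
      by (simp add: power_add power_mult_distrib mult_ac)
  qed
qed

lemma geo_tail_sums:
  assumes "geo_bounded q W" "0 \<le> a" "0 < q" "a * q < 1"
  shows "(\<lambda>j. a ^ j * W (j + e)) sums geo_tail a W e"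
  unfolding geo_tail_def using geo_bounded_summable[OF assms] by (rule summable_sums)

lemma geo_tail_rec:
  assumes "geo_bounded q W" "0 \<le> a" "0 < q" "a * q < 1"
  shows "geo_tail a W e = W e + a * geo_tail a W (Suc e)"
proof -
  have "geo_tail a W e = (\<Sum>j. a ^ Suc j * W (Suc j + e)) + a ^ 0 * W (0 + e)"
    unfolding geo_tail_def
    using suminf_split_head[OF geo_bounded_summable[OF assms, of e]] by simp
  also have "(\<Sum>j. a ^ Suc j * W (Suc j + e)) = a * geo_tail a W (Suc e)"
    unfolding geo_tail_def
    by (subst suminf_mult[OF geo_bounded_summable[OF assms], symmetric]) (simp add: mult_ac)
  finally show ?thesis by simp
qed

lemma geo_bounded_geo_tail:
  assumes "geo_bounded q W" "0 \<le> a" "0 < q" "a * q < 1"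
  shows "geo_bounded q (geo_tail a W)"
proof -
  obtain C where C: "C \<ge> 0" "\<And>n. 0 \<le> W n" "\<And>n. W n \<le> C * q ^ n"
    using assms(1) by (auto simp: geo_bounded_def)
  have "geo_tail a W e \<le> C / (1 - a * q) * q ^ e" for e
  proof (rule sums_le)
    show "(\<lambda>j. a ^ j * W (j + e)) sums geo_tail a W e"
      by (rule geo_tail_sums[OF assms])
    show "(\<lambda>j. C * q ^ e * (a * q) ^ j) sums (C / (1 - a * q) * q ^ e)"
      using sums_mult[OF geometric_sums[of "a * q"], of "C * q ^ e"] assms by simp
    show "a ^ j * W (j + e) \<le> C * q ^ e * (a * q) ^ j" for j
      using mult_left_mono[OF C(3)[of "j + e"], of "a ^ j"] assms
      by (simp add: power_add power_mult_distrib mult_ac)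
  qed
  moreover have "0 \<le> geo_tail a W e" for e
    unfolding geo_tail_def using C assms by (intro suminf_nonneg geo_bounded_summable) auto
  ultimately show ?thesis
    unfolding geo_bounded_def using C assms by (intro exI[of _ "C / (1 - a * q)"]) auto
qed

lemma geo_bounded_layer_step:
  assumes "geo_bounded q W" "0 \<le> a" "0 < q" "a * q < 1" "0 \<le> \<beta>" "\<beta> < q" "\<beta> * c2 < 1"
  shows "geo_bounded q (layer_step a c2 \<beta> W)"
proof -
  obtain C where C: "C \<ge> 0" "\<And>n. 0 \<le> geo_tail a W n" "\<And>n. geo_tail a W n \<le> C * q ^ n"
    using geo_bounded_geo_tail[OF assms(1-4)] by (auto simp: geo_bounded_def)
  \<comment> \<open>The first entry covers \<open>n = 0\<close>; the second is the least
    \<open>D\<close> with \<open>C * q + \<beta> * D \<le> D * q\<close>, which closes the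
    induction.\<close>
  define D where "D = max (C / (1 - \<beta> * c2)) (C * q / (q - \<beta>))"
  have D: "C / (1 - \<beta> * c2) \<le> D" "C * q / (q - \<beta>) \<le> D" by (auto simp: D_def)
  have D0: "0 \<le> D" using D(1) C assms by (intro order_trans[OF _ D(1)]) auto
  have step: "C * q + \<beta> * D \<le> D * q"
    using D(2) assms by (simp add: field_simps)
  have "0 \<le> layer_step a c2 \<beta> W n \<and> layer_step a c2 \<beta> W n \<le> D * q ^ n" for n
  proof (induction n)
    case 0
    have "geo_tail a W 0 / (1 - \<beta> * c2) \<le> C / (1 - \<beta> * c2)"
      using C(3)[of 0] assms by (intro divide_right_mono) auto
    then show ?case using C(2)[of 0] D(1) assms by (auto intro: order_trans)
  next
    case (Suc n)
    have "\<beta> * layer_step a c2 \<beta> W n \<le> \<beta> * (D * q ^ n)"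
      using Suc assms by (intro mult_left_mono) auto
    with C(3)[of "Suc n"]
    have "layer_step a c2 \<beta> W (Suc n) \<le> (C * q + \<beta> * D) * q ^ n"
      by (simp add: algebra_simps)
    also have "\<dots> \<le> (D * q) * q ^ n" using step assms by (intro mult_right_mono) auto
    finally show ?case using C(2)[of "Suc n"] Suc assms by (simp add: mult_ac)
  qed
  then show ?thesis using D0 by (auto simp: geo_bounded_def)
qed

text \<open>At state \<open>0\<close> the series is geometric. At \<open>Suc E\<close>, splitting
  off \<open>p = 0\<close> leaves \<open>\<beta>\<close> times the series at \<open>E\<close>, since
  both truncated differences are unchanged when \<open>p\<close> and \<open>E\<close> grow
  together.\<close>

lemma layer_step_sums:
  assumes "0 \<le> \<beta>" "0 < c2" "\<beta> * c2 < 1"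
  shows "(\<lambda>p. \<beta> ^ p * c2 ^ (p - E) * geo_tail a W (E - p)) sums layer_step a c2 \<beta> W E"
proof (induction E)
  case 0
  have "(\<lambda>p. (\<beta> * c2) ^ p * geo_tail a W 0) sums (1 / (1 - \<beta> * c2) * geo_tail a W 0)"
    by (intro sums_mult2 geometric_sums) (use assms in auto)
  then show ?case by (simp add: power_mult_distrib)
next
  case (Suc E)
  let ?f = "\<lambda>p. \<beta> ^ p * c2 ^ (p - Suc E) * geo_tail a W (Suc E - p)"
  have "(\<lambda>p. ?f (Suc p)) sums (\<beta> * layer_step a c2 \<beta> W E)"
    using sums_mult[OF Suc, of \<beta>] by (simp add: mult_ac)
  then have "?f sums (\<beta> * layer_step a c2 \<beta> W E + ?f 0)"
    by (rule sums_Suc)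
  then show ?case by (simp add: add.commute)
qed

text \<open>All terms are nonnegative, so summing first over \<open>r\<close> and then over
  \<open>p\<close> yields the unconditional sum over pairs.\<close>

lemma layer_step_has_sum:
  assumes "geo_bounded q W" "0 \<le> a" "0 < q" "a * q < 1" "0 \<le> \<beta>" "0 < c2" "\<beta> * c2 < 1"
  shows "((\<lambda>(p, r). \<beta> ^ p * a ^ r * c2 ^ (p - E) * W (r + (E - p)))
           has_sum layer_step a c2 \<beta> W E) (UNIV \<times> UNIV)"
proof -
  define f where "f = (\<lambda>(p, r). \<beta> ^ p * a ^ r * c2 ^ (p - E) * W (r + (E - p)))"
  have W: "0 \<le> W n" for n using assms(1) by (rule geo_bounded_nonneg)
  have inner: "((\<lambda>r. f (p, r)) has_sum \<beta> ^ p * c2 ^ (p - E) * geo_tail a W (E - p)) UNIV" for p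
  proof (rule sums_nonneg_imp_has_sum)
    show "(\<lambda>r. f (p, r)) sums (\<beta> ^ p * c2 ^ (p - E) * geo_tail a W (E - p))"
      using sums_mult[OF geo_tail_sums[OF assms(1-4)], of "\<beta> ^ p * c2 ^ (p - E)" "E - p"]
      by (simp add: f_def mult_ac)
  qed (use assms W in \<open>auto simp: f_def\<close>)
  have outer: "((\<lambda>p. \<beta> ^ p * c2 ^ (p - E) * geo_tail a W (E - p))
      has_sum layer_step a c2 \<beta> W E) UNIV"
    using geo_bounded_nonneg[OF geo_bounded_geo_tail[OF assms(1-4)]] assms
    by (intro sums_nonneg_imp_has_sum layer_step_sums) auto
  have "f summable_on (UNIV \<times> UNIV)"
    by (rule summable_on_SigmaI[OF inner has_sum_imp_summable[OF outer]])
       (use assms W in \<open>auto simp: f_def\<close>)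
  then have "(f has_sum layer_step a c2 \<beta> W E) (UNIV \<times> UNIV)"
    by (rule has_sum_SigmaI[OF inner outer])
  then show ?thesis by (simp add: f_def)
qed

section \<open>Path sums as iterated transfer steps\<close>

text \<open>The summand for paths started in an arbitrary state \<open>E\<close>, which acts as an additional increment
  of the second path after step \<open>N\<close>.\<close>

definition state_term ::
    "nat \<Rightarrow> real \<Rightarrow> real \<Rightarrow> real \<Rightarrow> (nat \<Rightarrow> real) \<Rightarrow> nat \<Rightarrow> (nat \<Rightarrow> nat) \<times> (nat \<Rightarrow> nat) \<Rightarrow> real"
  where
  "state_term N a c1 c2 t E = (\<lambda>(m, n).
     (\<Prod>j=1..N. t j ^ (2 * m j)) * a ^ height m N * a ^ height n N
     * (c1 * c2) powi (Max (insert (int (height n N) + int E - int (height m N))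
         ((\<lambda>j. int (height n j) - int (height m (j - 1))) ` {1..N})))
     * c2 powi (int (height m N) - int (height n N) - int E))"

lemma height_Suc: "height m (Suc j) = height m j + m (Suc j)"
  by (simp add: height_def)

lemma height_upd: "j \<le> N \<Longrightarrow> height (m(Suc N := p)) j = height m j"
  by (auto simp: height_def intro!: sum.cong)

text \<open>For \<open>E = 0\<close> the inserted entry of the maximum is dominated by the entry
  \<open>j = N\<close>, which subtracts the smaller height at \<open>N - 1\<close>.\<close>

lemma gen_fun_term_eq_state_term:
  assumes "N \<ge> 1"
  shows "gen_fun_term N a c1 c2 t = state_term N a c1 c2 t 0"
proof -
  have "Max (insert (int (height n N) - int (height m N))
          ((\<lambda>j. int (height n j) - int (height m (j - 1))) ` {1..N}))
      = Max ((\<lambda>j. int (height n j) - int (height m (j - 1))) ` {1..N})" for m n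
  proof -
    obtain M where M: "N = Suc M" using assms by (cases N) auto
    have "int (height n N) - int (height m N) \<le> int (height n N) - int (height m (N - 1))"
      by (simp add: M height_Suc)
    also have "\<dots> \<le> Max ((\<lambda>j. int (height n j) - int (height m (j - 1))) ` {1..N})"
      using assms by (intro Max_ge) auto
    finally show ?thesis using assms by (subst Max_insert) auto
  qed
  moreover have "(\<Prod>j=1..N. t j ^ (2 * (height m j - height m (j - 1)))) = (\<Prod>j=1..N. t j ^ (2 * m j))"
    for m
  proof (rule prod.cong)
    fix j assume "j \<in> {1..N}"
    then obtain i where "j = Suc i" by (cases j) auto
    then show "t j ^ (2 * (height m j - height m (j - 1))) = t j ^ (2 * m j)"
      by (simp add: height_Suc)
  qed simp
  ultimately show ?thesis
    by (auto simp: gen_fun_term_def two_layer_weight_def state_term_def fun_eq_iff mult_ac)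
qed

text \<open>The Lindley step: the entry at \<open>Suc N\<close> and the one from the initial state
  merge, because \<open>r + max 0 (E - p)\<close> is the new state. The truncated
  \<open>E - p\<close> and \<open>p - E\<close> are the positive and negative parts of the
  difference.\<close>

lemma state_term_Suc:
  assumes "0 < c1" "0 < c2"
  shows "state_term (Suc N) a c1 c2 t E (m(Suc N := p), n(Suc N := r)) =
    (a * (t (Suc N))\<^sup>2) ^ p * a ^ r * c2 ^ (p - E) * state_term N a c1 c2 t (r + (E - p)) (m, n)"
proof -
  let ?g = "\<lambda>j. int (height n j) - int (height m (j - 1))"
  let ?m = "m(Suc N := p)" and ?n = "n(Suc N := r)"
  have img: "(\<lambda>j. int (height ?n j) - int (height ?m (j - 1))) ` {1..Suc N} =
      insert (int (height n N + r) - int (height m N)) (?g ` {1..N})"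
  proof -
    have "{1..Suc N} = insert (Suc N) {1..N}" by auto
    moreover have "(\<lambda>j. int (height ?n j) - int (height ?m (j - 1))) ` {1..N} = ?g ` {1..N}"
      by (intro image_cong) (auto simp: height_upd)
    ultimately show ?thesis by (simp add: height_Suc height_upd)
  qed
  \<comment> \<open>The set \<open>A\<close> is empty when \<open>N = 0\<close>, a case in which
    \<open>Max A\<close> carries no information.\<close>
  have mx: "Max (insert (x + int E - y - int p) (insert x' A)) = Max (insert z A)"
    if "finite A" "max (x + int E - y - int p) x' = z" for A x y x' z
    using that by (cases "A = {}") (auto simp: max.assoc[symmetric])
  have Max: "Max (insert (int (height ?n (Suc N)) + int E - int (height ?m (Suc N)))
        ((\<lambda>j. int (height ?n j) - int (height ?m (j - 1))) ` {1..Suc N})) =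
      Max (insert (int (height n N) + int (r + (E - p)) - int (height m N)) (?g ` {1..N}))"
    unfolding img
    by (rule trans[OF _ mx[of _ "int (height n N + r)" "int (height m N)"
            "int (height n N + r) - int (height m N)"]])
       (auto simp: height_Suc height_upd max_def algebra_simps)
  have e: "int (height ?m (Suc N)) - int (height ?n (Suc N)) - int E =
     int (p - E) + (int (height m N) - int (height n N) - int (r + (E - p)))"
    by (auto simp: height_Suc height_upd)
  have c: "c2 powi (int (height ?m (Suc N)) - int (height ?n (Suc N)) - int E) =
     c2 ^ (p - E) * c2 powi (int (height m N) - int (height n N) - int (r + (E - p)))"
    unfolding e using assms by (subst power_int_add) auto
  have pr: "(\<Prod>j=1..Suc N. t j ^ (2 * ?m j)) = (\<Prod>j=1..N. t j ^ (2 * m j)) * t (Suc N) ^ (2 * p)"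
    by (auto intro!: prod.cong)
  show ?thesis
    unfolding state_term_def prod.case Max c pr
    by (simp add: height_Suc height_upd power_add power_mult_distrib power_mult[symmetric] mult_ac)
qed

text \<open>The inverse resets coordinate \<open>Suc N\<close> to \<open>undefined\<close>, the
  value of an extensional function off its domain.\<close>

lemma bij_betw_increment_pairs:
  "bij_betw (\<lambda>((p, r), (m, n)). (m(Suc N := p), n(Suc N := r)))
     ((UNIV \<times> UNIV) \<times> increment_pairs N) (increment_pairs (Suc N))"
proof (rule bij_betwI[where
      g = "\<lambda>(m, n). ((m (Suc N), n (Suc N)), (m(Suc N := undefined), n(Suc N := undefined)))"])
qed (auto simp: increment_pairs_def PiE_def extensional_def Pi_def fun_eq_iff)

lemma state_term_nonneg:
  assumes "0 < a" "0 < c1" "0 < c2"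
  shows "0 \<le> state_term N a c1 c2 t E mn"
  using assms by (auto simp: state_term_def power_mult split: prod.splits
      intro!: mult_nonneg_nonneg prod_nonneg zero_le_power_int)

text \<open>Induction on \<open>N\<close>, splitting off the last pair of increments; nonnegativity
  permits summation in stages. The growth bound is carried along because each transfer step needs it
  to converge.\<close>

lemma state_term_has_sum:
  assumes "0 < a" "0 < c1" "0 < c2" "c1 \<le> q" "a * q < 1"
    "\<And>j. 1 \<le> j \<Longrightarrow> j \<le> N \<Longrightarrow> a * (t j)\<^sup>2 < q"
    "\<And>j. 1 \<le> j \<Longrightarrow> j \<le> N \<Longrightarrow> a * (t j)\<^sup>2 * c2 < 1"
  shows "geo_bounded q (layer_weight a c1 c2 t N)"
    and "(state_term N a c1 c2 t E has_sum layer_weight a c1 c2 t N E) (increment_pairs N)"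
proof -
  have "geo_bounded q (layer_weight a c1 c2 t N) \<and>
    (\<forall>E. (state_term N a c1 c2 t E has_sum layer_weight a c1 c2 t N E) (increment_pairs N))"
    using assms(6,7)
  proof (induction N)
    case 0
    have "increment_pairs 0 = {(\<lambda>_. undefined, \<lambda>_. undefined)}"
      by (auto simp: increment_pairs_def)
    \<comment> \<open>Without steps the maximum is \<open>E\<close>, so the weight is
      \<open>(c1 * c2) ^ E\<close> divided by \<open>c2 ^ E\<close>: the terminal weight.\<close>
    moreover have "state_term 0 a c1 c2 t E (\<lambda>_. undefined, \<lambda>_. undefined) = c1 ^ E" for E
      using assms by (simp add: state_term_def height_def power_int_minus power_mult_distrib)
    ultimately have "(state_term 0 a c1 c2 t E has_sum c1 ^ E) (increment_pairs 0)" for E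
      using has_sum_finite[of "increment_pairs 0" "state_term 0 a c1 c2 t E"] by simp
    moreover have "geo_bounded q (\<lambda>E. c1 ^ E)"
      unfolding geo_bounded_def using assms by (intro exI[of _ 1]) (auto intro: power_mono)
    ultimately show ?case by simp
  next
    case (Suc N)
    let ?W = "layer_weight a c1 c2 t N" and ?\<beta> = "a * (t (Suc N))\<^sup>2"
    have IH: "geo_bounded q ?W" "\<And>E. (state_term N a c1 c2 t E has_sum ?W E) (increment_pairs N)"
      using Suc by auto
    have q: "0 < q" "0 \<le> ?\<beta>" "?\<beta> < q" "?\<beta> * c2 < 1"
      using assms Suc.prems by auto
    have a: "0 \<le> a" using assms by simp
    have "(state_term (Suc N) a c1 c2 t E has_sum layer_step a c2 ?\<beta> ?W E) (increment_pairs (Suc N))"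
      for E
    proof -
      define F where "F = (\<lambda>((p, r), mn). ?\<beta> ^ p * a ^ r * c2 ^ (p - E)
          * state_term N a c1 c2 t (r + (E - p)) mn)"
      define G where "G = (\<lambda>(p, r). ?\<beta> ^ p * a ^ r * c2 ^ (p - E) * ?W (r + (E - p)))"
      have inner: "((\<lambda>mn. F (pr, mn)) has_sum G pr) (increment_pairs N)" for pr
        unfolding F_def G_def by (cases pr) (auto intro!: has_sum_cmult_right IH)
      have outer: "(G has_sum layer_step a c2 ?\<beta> ?W E) (UNIV \<times> UNIV)"
        unfolding G_def by (rule layer_step_has_sum) (use IH q a assms in auto)
      have "F summable_on (UNIV \<times> UNIV) \<times> increment_pairs N"
        by (rule summable_on_SigmaI[OF inner has_sum_imp_summable[OF outer]])
           (use assms state_term_nonneg[OF assms(1-3)] in \<open>auto simp: F_def\<close>)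
      then have "(F has_sum layer_step a c2 ?\<beta> ?W E) ((UNIV \<times> UNIV) \<times> increment_pairs N)"
        by (rule has_sum_SigmaI[OF inner outer])
      moreover have "F = (\<lambda>x. state_term (Suc N) a c1 c2 t E
          ((\<lambda>((p, r), (m, n)). (m(Suc N := p), n(Suc N := r))) x))"
        unfolding F_def by (auto simp: fun_eq_iff state_term_Suc[OF assms(2,3)])
      ultimately show ?thesis
        using has_sum_reindex_bij_betw[OF bij_betw_increment_pairs[of N],
            of "state_term (Suc N) a c1 c2 t E"] by simp
    qed
    moreover have "geo_bounded q (layer_step a c2 ?\<beta> ?W)"
      by (rule geo_bounded_layer_step) (use IH q a assms in auto)
    ultimately show ?case by simp
  qed
  then show "geo_bounded q (layer_weight a c1 c2 t N)"
    and "(state_term N a c1 c2 t E has_sum layer_weight a c1 c2 t N E) (increment_pairs N)"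
    by auto
qed

section \<open>Generating functions of the state weights and their functional equation\<close>

definition layer_gf :: "(nat \<Rightarrow> real) \<Rightarrow> complex \<Rightarrow> complex" where
  "layer_gf W y = (\<Sum>n. of_real (W n) * y ^ n)"

lemma layer_gf_sums:
  assumes "geo_bounded q W" "0 < q" "norm y * q < 1"
  shows "(\<lambda>n. of_real (W n) * y ^ n) sums layer_gf W y"
  unfolding layer_gf_def
proof (rule summable_sums, rule summable_norm_cancel)
  show "summable (\<lambda>n. norm (of_real (W n) * y ^ n))"
    using geo_bounded_summable[OF assms(1) norm_ge_zero assms(2,3), of 0]
      geo_bounded_nonneg[OF assms(1)]
    by (simp add: norm_mult norm_power mult_ac)
qed

lemma layer_gf_holomorphic:
  assumes "geo_bounded q W" "0 < q"
  shows "layer_gf W holomorphic_on ball 0 (1 / q)"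
proof (rule power_series_holomorphic)
  fix w :: complex assume "w \<in> ball 0 (1 / q)"
  then have "norm w * q < 1" using assms by (simp add: field_simps)
  then show "(\<lambda>n. of_real (W n) * (w - 0) ^ n) sums layer_gf W w"
    using layer_gf_sums[OF assms] by simp
qed

lemma layer_gf_at_real:
  assumes "geo_bounded q W" "0 \<le> a" "0 < q" "a * q < 1"
  shows "layer_gf W (of_real a) = of_real (geo_tail a W 0)"
proof -
  have "(\<lambda>n. complex_of_real (a ^ n * W (n + 0))) sums of_real (geo_tail a W 0)"
    by (intro sums_of_real geo_tail_sums[OF assms])
  then show ?thesis
    using layer_gf_sums[OF assms(1,3), of "of_real a"] assms(2-4)
    by (intro sums_unique2) (simp_all add: mult_ac)
qed

text \<open>Multiply the recursion \<open>geo_tail_rec\<close> at index \<open>n\<close> by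
  \<open>y ^ Suc n\<close> and sum over \<open>n\<close>.\<close>

lemma layer_gf_geo_tail:
  assumes "geo_bounded q W" "0 \<le> a" "0 < q" "a * q < 1" "norm y * q < 1"
  shows "(y - of_real a) * layer_gf (geo_tail a W) y = y * layer_gf W y - of_real (a * geo_tail a W 0)"
proof -
  let ?U = "geo_tail a W"
  let ?L = "layer_gf ?U y"
  have U: "(\<lambda>n. of_real (?U n) * y ^ n) sums ?L"
    by (rule layer_gf_sums[OF geo_bounded_geo_tail[OF assms(1-4)] assms(3,5)])
  have "(\<lambda>n. of_real (?U (Suc n)) * y ^ Suc n) sums (?L - of_real (?U 0))"
    using U by (subst sums_Suc_iff) simp
  then have "(\<lambda>n. of_real a * (of_real (?U (Suc n)) * y ^ Suc n)) sums (of_real a * (?L - of_real (?U 0)))"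
    by (rule sums_mult)
  moreover have "(\<lambda>n. y * (of_real (?U n) * y ^ n - of_real (W n) * y ^ n)) sums (y * (?L - layer_gf W y))"
    by (intro sums_mult sums_diff U layer_gf_sums[OF assms(1,3,5)])
  moreover have "of_real a * (of_real (?U (Suc n)) * y ^ Suc n) = y * (of_real (?U n) * y ^ n - of_real (W n) * y ^ n)" for n
    by (subst (2) geo_tail_rec[OF assms(1-4)]) (simp add: algebra_simps)
  ultimately have "of_real a * (?L - of_real (?U 0)) = y * (?L - layer_gf W y)"
    by (simp only: sums_unique2)
  then show ?thesis by (simp add: algebra_simps)
qed

text \<open>The recursion of \<open>layer_step\<close> expresses
  \<open>(1 - \<beta> * y) * ?M\<close> through \<open>?L\<close> and the two constant coefficients;
  \<open>layer_gf_geo_tail\<close> then eliminates \<open>?L\<close>, and \<open>?U 0\<close> is the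
  old generating function at \<open>a\<close>.\<close>

lemma layer_gf_layer_step:
  assumes "geo_bounded q W" "0 \<le> a" "0 < q" "a * q < 1" "0 \<le> \<beta>" "\<beta> < q" "\<beta> * c2 < 1"
    and y: "norm y * q < 1"
  shows "(y - of_real a) * (1 - of_real \<beta> * y) * layer_gf (layer_step a c2 \<beta> W) y =
    y * layer_gf W y - layer_gf W (of_real a) * (of_real a - of_real (\<beta> * c2) * y) / (1 - of_real (\<beta> * c2))"
proof -
  let ?U = "geo_tail a W" and ?S = "layer_step a c2 \<beta> W"
  let ?L = "layer_gf ?U y" and ?M = "layer_gf ?S y"
  have U: "(\<lambda>n. of_real (?U n) * y ^ n) sums ?L"
    by (rule layer_gf_sums[OF geo_bounded_geo_tail[OF assms(1-4)] assms(3,8)])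
  have S: "(\<lambda>n. of_real (?S n) * y ^ n) sums ?M"
    by (rule layer_gf_sums[OF geo_bounded_layer_step[OF assms(1-7)] assms(3,8)])
  have "(\<lambda>n. of_real (?U (Suc n)) * y ^ Suc n + of_real \<beta> * y * (of_real (?S n) * y ^ n))
      sums (?L - of_real (?U 0) + of_real \<beta> * y * ?M)"
    using U by (intro sums_add sums_mult S, subst sums_Suc_iff) simp
  moreover have "(\<lambda>n. of_real (?S (Suc n)) * y ^ Suc n) sums (?M - of_real (?S 0))"
    using S by (subst sums_Suc_iff) simp
  moreover have "of_real (?S (Suc n)) * y ^ Suc n =
      of_real (?U (Suc n)) * y ^ Suc n + of_real \<beta> * y * (of_real (?S n) * y ^ n)" for n
    by (simp add: algebra_simps)
  ultimately have "?M - of_real (?S 0) = ?L - of_real (?U 0) + of_real \<beta> * y * ?M"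
    by (simp only: sums_unique2)
  \<comment> \<open>The coefficient \<open>?S 0\<close> is \<open>?U 0 / (1 - \<beta> * c2)\<close>;
    through it \<open>c2\<close> enters the equation.\<close>
  then have M: "(1 - of_real \<beta> * y) * ?M = ?L - (of_real (?U 0) - of_real (?U 0) / (1 - of_real (\<beta> * c2)))"
    by (simp add: algebra_simps)
  have "(y - of_real a) * (1 - of_real \<beta> * y) * ?M =
     (y - of_real a) * ?L - (y - of_real a) * (of_real (?U 0) - of_real (?U 0) / (1 - of_real (\<beta> * c2)))"
    by (simp only: mult.assoc M) (simp only: right_diff_distrib)
  moreover have "(1 - complex_of_real (\<beta> * c2)) \<noteq> 0"
    using assms(7) by (metis less_irrefl of_real_1 of_real_eq_iff right_minus_eq)
  ultimately show ?thesis
    unfolding layer_gf_geo_tail[OF assms(1-4) y] layer_gf_at_real[OF assms(1-4)]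
    by (simp add: field_simps)
qed

section \<open>Elliptic domains\<close>

text \<open>With \<open>w = exp z\<close> the annulus, completed by its image under
  \<open>w \<mapsto> 1 / w\<close>, becomes an open convex strip, from which openness and
  connectedness of the ellipse are inherited.\<close>

lemma ellipse_dom_eq_strip:
  assumes "0 < \<rho>"
  shows "ellipse_dom \<rho> = (\<lambda>z. exp z + exp (- z)) ` {z. ln \<rho> < Re z \<and> Re z < - ln \<rho>}"
proof (intro subset_antisym subsetI)
  fix x assume "x \<in> ellipse_dom \<rho>"
  then obtain w where w: "x = w + 1 / w" "\<rho> < norm w" "norm w \<le> 1"
    by (auto simp: ellipse_dom_def)
  have w0: "w \<noteq> 0" using w assms by auto
  have "ln \<rho> < Re (Ln w)" using w w0 assms by simp
  moreover have "Re (Ln w) < - ln \<rho>"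
  proof -
    have "ln \<rho> < 0" using w assms by (intro ln_less_zero) auto
    moreover have "Re (Ln w) \<le> 0" using w w0 by simp
    ultimately show ?thesis by linarith
  qed
  moreover have "x = exp (Ln w) + exp (- Ln w)"
    using w0 by (simp add: exp_minus w field_simps)
  ultimately show "x \<in> (\<lambda>z. exp z + exp (- z)) ` {z. ln \<rho> < Re z \<and> Re z < - ln \<rho>}"
    by blast
next
  fix x assume "x \<in> (\<lambda>z. exp z + exp (- z)) ` {z. ln \<rho> < Re z \<and> Re z < - ln \<rho>}"
  then obtain z where z: "x = exp z + exp (- z)" "ln \<rho> < Re z" "Re z < - ln \<rho>" by auto
  \<comment> \<open>Changing the sign of \<open>z\<close> keeps \<open>x\<close> and moves
    \<open>exp z\<close> into the closed unit disc.\<close>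
  define v where "v = (if Re z \<le> 0 then z else - z)"
  have v: "x = exp v + 1 / exp v" "ln \<rho> < Re v" "Re v \<le> 0"
    using z by (auto simp: v_def exp_minus field_simps)
  have "\<rho> < norm (exp v)"
    using v(2) assms by (metis exp_less_mono exp_ln norm_exp_eq_Re)
  then show "x \<in> ellipse_dom \<rho>"
    using v unfolding ellipse_dom_def by (intro CollectI exI[of _ "exp v"]) auto
qed

lemma convex_strip: "convex {z. a < Re z \<and> Re z < b}" and open_strip: "open {z. a < Re z \<and> Re z < b}"
proof -
  have "{z. a < Re z \<and> Re z < b} = {z. Re z > a} \<inter> {z. Re z < b}" by auto
  then show "convex {z. a < Re z \<and> Re z < b}" "open {z. a < Re z \<and> Re z < b}"
    by (simp_all add: convex_Int convex_halfspace_Re_gt convex_halfspace_Re_lt open_Int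
        open_halfspace_Re_gt open_halfspace_Re_lt)
qed

lemma connected_ellipse_dom: "0 < \<rho> \<Longrightarrow> connected (ellipse_dom \<rho>)"
  unfolding ellipse_dom_eq_strip
  by (intro connected_continuous_image continuous_intros convex_connected convex_strip)

text \<open>The open mapping theorem on the strip; non-constancy is seen by comparing the value 2 at
  the origin with the value at a positive real point.\<close>

lemma open_ellipse_dom:
  assumes "0 < \<rho>"
  shows "open (ellipse_dom \<rho>)"
proof (cases "\<rho> < 1")
  case True
  let ?S = "{z. ln \<rho> < Re z \<and> Re z < - ln \<rho>}" and ?f = "\<lambda>z::complex. exp z + exp (- z)"
  have "\<not> ?f constant_on ?S"
  proof
    assume "?f constant_on ?S"
    moreover have l: "ln \<rho> < 0" using True assms by simp
    define s where "s = - ln \<rho> / 2"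
    have "0 \<in> ?S" "of_real s \<in> ?S" using l by (auto simp: s_def)
    ultimately have "?f (of_real s) = ?f 0" unfolding constant_on_def by metis
    then have "complex_of_real (exp s + exp (- s)) = of_real 2"
      by (simp add: exp_of_real[symmetric])
    then have "exp s + exp (- s) = 2" by (simp only: of_real_eq_iff)
    then have "exp s + 1 / exp s = 2" by (simp add: exp_minus field_simps)
    then have "(exp s - 1)\<^sup>2 = 0" by (simp add: field_simps power2_eq_square)
    then show False using l by (simp add: s_def)
  qed
  then show ?thesis
    unfolding ellipse_dom_eq_strip[OF assms]
    by (intro open_mapping_thm[where S = ?S] holomorphic_intros open_strip convex_connected convex_strip)
      auto
next
  case False
  then have "ellipse_dom \<rho> = {}" by (auto simp: ellipse_dom_def)
  then show ?thesis by simp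
qed

lemma ellipse_dom_mono: "\<rho> \<le> \<rho>' \<Longrightarrow> ellipse_dom \<rho>' \<subseteq> ellipse_dom \<rho>"
  by (force simp: ellipse_dom_def)

section \<open>The map \<open>w + 1 / w\<close> and its inverse branch \<open>frak_u\<close>\<close>

lemma joukowski_eq_iff:
  fixes u w :: complex
  assumes "u \<noteq> 0" "w \<noteq> 0"
  shows "u + 1 / u = w + 1 / w \<longleftrightarrow> u = w \<or> u * w = 1"
proof -
  have "u + 1 / u = w + 1 / w \<longleftrightarrow> (u - w) * (u * w - 1) = 0"
    using assms by (auto simp: field_simps)
  then show ?thesis by simp
qed

lemma joukowski_mem_ellipse_dom:
  assumes "0 < \<rho>" "\<rho> < norm w" "norm w < 1 / \<rho>"
  shows "w + 1 / w \<in> ellipse_dom \<rho>"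
proof (cases "norm w \<le> 1")
  case True
  then show ?thesis using assms by (auto simp: ellipse_dom_def)
next
  case False
  have w: "w \<noteq> 0" using assms by auto
  show ?thesis unfolding ellipse_dom_def
    using assms False w
    by (intro CollectI exI[of _ "1 / w"]) (auto simp: norm_divide field_simps)
qed

lemma norm_root_of_ellipse_dom:
  assumes "0 < \<rho>" "u + 1 / u \<in> ellipse_dom \<rho>" "u \<noteq> 0" "norm u \<le> 1"
  shows "\<rho> < norm u"
proof -
  obtain w where w: "u + 1 / u = w + 1 / w" "\<rho> < norm w" "norm w \<le> 1"
    using assms(2) by (auto simp: ellipse_dom_def)
  have "w \<noteq> 0" using w assms by auto
  then consider "u = w" | "u * w = 1" using joukowski_eq_iff[OF assms(3)] w by auto
  then show ?thesis
  proof cases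
    \<comment> \<open>Two numbers in the closed unit disc with product 1 both have norm 1.\<close>
    case 2
    then have "norm u * norm w = 1" by (metis norm_mult norm_one)
    with w assms have "norm w \<le> norm u"
      by (smt (verit) mult_left_le mult_left_mono norm_ge_zero)
    with w show ?thesis by simp
  qed (use w in simp)
qed

lemma segment_joukowski:
  assumes "-2 \<le> x" "x \<le> 2"
  shows "\<exists>\<theta>\<in>{0..pi}. x = 2 * cos \<theta>"
  using assms by (intro bexI[of _ "arccos (x / 2)"]) (auto simp: arccos_lbound arccos_ubound)

lemma joukowski_unit: "exp (\<i> * of_real \<theta>) + 1 / exp (\<i> * of_real \<theta>) = of_real (2 * cos \<theta>)"
proof -
  have "exp (\<i> * of_real \<theta>) = cis \<theta>" by (simp add: cis_conv_exp)
  then show ?thesis by (simp add: complex_eq_iff divide_inverse)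
qed

lemma segment_subset_ellipse_dom:
  assumes "\<rho> < 1"
  shows "complex_of_real ` {-2..2} \<subseteq> ellipse_dom \<rho>"
proof clarify
  fix x :: real assume "x \<in> {-2..2}"
  then obtain \<theta> where "x = 2 * cos \<theta>" using segment_joukowski by auto
  then have "of_real x = exp (\<i> * of_real \<theta>) + 1 / exp (\<i> * of_real \<theta>)"
    using joukowski_unit by simp
  then show "of_real x \<in> ellipse_dom \<rho>"
    unfolding ellipse_dom_def using assms
    by (intro CollectI exI[of _ "exp (\<i> * of_real \<theta>)"]) simp
qed

lemma segment_subset_ellipse_cdom: "r \<le> 1 \<Longrightarrow> complex_of_real ` {-2..2} \<subseteq> ellipse_cdom r"
  using segment_subset_ellipse_dom[of r] closure_subset[of "ellipse_dom r"]
  by (cases "r = 1") (simp_all add: ellipse_cdom_def)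

text \<open>Both descriptions in \<open>frak_u\<close> need existence and uniqueness. On the segment
  this is injectivity of the cosine on \<open>[0, pi]\<close>. Off it, the two roots are mutually
  inverse and neither has norm 1, so exactly one lies inside the unit disc.\<close>

lemma
  shows frak_u_nonzero: "frak_u x \<noteq> 0"
    and frak_u_root: "frak_u x + 1 / frak_u x = x"
    and norm_frak_u_le: "norm (frak_u x) \<le> 1"
proof -
  have "frak_u x \<noteq> 0 \<and> frak_u x + 1 / frak_u x = x \<and> norm (frak_u x) \<le> 1"
  proof (cases "x \<in> complex_of_real ` {-2..2}")
    case True
    then obtain \<theta> where \<theta>: "\<theta> \<in> {0..pi}" "x = of_real (2 * cos \<theta>)"
      using segment_joukowski by fastforce
    have "frak_u x = exp (\<i> * of_real \<theta>)"
      unfolding frak_u_def using True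
    proof (simp only: if_True, intro the_equality bexI conjI)
      fix u assume "\<exists>\<theta>\<in>{0..pi}. x = of_real (2 * cos \<theta>) \<and> u = exp (\<i> * of_real \<theta>)"
      then obtain \<theta>' where \<theta>': "\<theta>' \<in> {0..pi}" "x = of_real (2 * cos \<theta>')" "u = exp (\<i> * of_real \<theta>')"
        by blast
      have "cos \<theta> = cos \<theta>'" using \<theta>(2) \<theta>'(2) by (simp only: of_real_eq_iff)
      then have "\<theta> = \<theta>'" using \<theta>(1) \<theta>'(1) by (auto intro: cos_inj_pi)
      then show "u = exp (\<i> * of_real \<theta>)" using \<theta>' by simp
    qed (use \<theta> in auto)
    then show ?thesis using joukowski_unit[of \<theta>] \<theta> by simp
  next
    case False
    \<comment> \<open>A root of \<open>w\<^sup>2 - x * w + 1\<close>, by the quadratic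
      formula.\<close>
    define w where "w = (x + csqrt (x\<^sup>2 - 4)) / 2"
    have w: "w * (x - w) = 1"
    proof -
      have "w * (x - w) = (x\<^sup>2 - (csqrt (x\<^sup>2 - 4))\<^sup>2) / 4"
        unfolding w_def by (simp add: field_simps power2_eq_square)
      then show ?thesis by simp
    qed
    then have w0: "w \<noteq> 0" by auto
    with w have wx: "w + 1 / w = x" by (simp add: field_simps)
    \<comment> \<open>A root of norm 1 would put \<open>x\<close> on the segment.\<close>
    have n: "norm v \<noteq> 1" if "v + 1 / v = x" for v
    proof
      assume "norm v = 1"
      then obtain \<theta> where "v = exp (\<i> * of_real \<theta>)"
        by (metis complex_norm_eq_1_exp)
      then have "x = of_real (2 * cos \<theta>)" using that joukowski_unit by simp
      moreover have "2 * cos \<theta> \<in> {-2..2}" using cos_ge_minus_one[of \<theta>] cos_le_one[of \<theta>] by auto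
      ultimately show False using False by blast
    qed
    obtain v where v: "v \<noteq> 0" "v + 1 / v = x" "norm v < 1"
    proof (cases "norm w < 1")
      case True
      then show ?thesis using that w0 wx by blast
    next
      case False
      then have "norm (1 / w) < 1" using n[OF wx] w0 by (simp add: norm_divide field_simps)
      then show ?thesis using that[of "1 / w"] w0 wx by (simp add: add.commute)
    qed
    have "frak_u x = v"
      unfolding frak_u_def using False
    proof (simp only: if_False, intro the_equality conjI)
      fix u assume u: "u \<noteq> 0 \<and> u + 1 / u = x \<and> norm u < 1"
      have "norm u * norm v \<le> norm u * 1" using v by (intro mult_left_mono) auto
      also have "\<dots> < 1" using u by simp
      finally have "norm (u * v) < 1" by (simp add: norm_mult)
      then have "u * v \<noteq> 1" by auto
      then show "u = v" using joukowski_eq_iff[of u v] u v by auto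
    qed (use v in auto)
    then show ?thesis using v by simp
  qed
  then show "frak_u x \<noteq> 0" "frak_u x + 1 / frak_u x = x" "norm (frak_u x) \<le> 1" by auto
qed

lemma norm_frak_u_gt: "0 < \<rho> \<Longrightarrow> x \<in> ellipse_dom \<rho> \<Longrightarrow> \<rho> < norm (frak_u x)"
  using norm_root_of_ellipse_dom[of \<rho> "frak_u x"] frak_u_nonzero frak_u_root norm_frak_u_le by simp

section \<open>Askey--Wilson functionals as contour integrals\<close>

lemma AW_radius_ge_1: "1 \<le> AW_radius a b c"
  by (simp add: AW_radius_def)

lemma less_inverse_AW_radius_iff:
  assumes "0 < \<rho>"
  shows "\<rho> < 1 / AW_radius a b c \<longleftrightarrow>
    \<rho> < 1 \<and> \<rho> * norm a < 1 \<and> \<rho> * norm b < 1 \<and> \<rho> * norm c < 1"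
proof -
  have "\<rho> < 1 / AW_radius a b c \<longleftrightarrow> AW_radius a b c < 1 / \<rho>"
    using AW_radius_ge_1[of a b c] assms by (simp add: field_simps)
  also have "\<dots> \<longleftrightarrow> 1 < 1 / \<rho> \<and> norm a < 1 / \<rho> \<and> norm b < 1 / \<rho> \<and> norm c < 1 / \<rho>"
    by (auto simp: AW_radius_def)
  finally show ?thesis using assms by (simp add: field_simps)
qed

lemma one_minus_mult_nonzero:
  fixes a w :: complex
  assumes "norm w * norm a < 1"
  shows "1 - a * w \<noteq> 0"
proof
  assume "1 - a * w = 0"
  then have "norm a * norm w = 1" by (metis eq_iff_diff_eq_0 norm_mult norm_one)
  with assms show False by (simp add: mult.commute)
qed

lemma circlepath_annulus_homotopic:
  assumes "0 < \<rho>" "\<rho> < r" "r < R" "\<rho> < s" "s < R"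
  shows "homotopic_loops (ball 0 R - cball 0 \<rho>) (circlepath 0 r) (circlepath 0 s)"
proof (rule homotopic_loops_linear)
  fix x :: real
  show "closed_segment (circlepath 0 r x) (circlepath 0 s x) \<subseteq> ball 0 R - cball 0 \<rho>"
  proof
    fix w assume "w \<in> closed_segment (circlepath 0 r x) (circlepath 0 s x)"
    then obtain u where u: "0 \<le> u" "u \<le> 1"
      "w = (1 - u) *\<^sub>R circlepath 0 r x + u *\<^sub>R circlepath 0 s x"
      by (auto simp: closed_segment_def)
    \<comment> \<open>Points of the two circles at equal parameter lie on one ray, so the norm along
      the segment is a convex combination of the radii.\<close>
    have "w = of_real ((1 - u) * r + u * s) * exp (2 * of_real pi * \<i> * of_real x)"
      unfolding u(3) circlepath by (simp add: scaleR_conv_of_real algebra_simps)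
    then have n: "norm w = \<bar>(1 - u) * r + u * s\<bar>"
      by (simp add: norm_mult del: of_real_add of_real_mult)
    have "\<rho> < (1 - u) * r + u * s" "(1 - u) * r + u * s < R"
      using u(1,2) assms convex_bound_lt[of r R s "1 - u" u]
        convex_bound_lt[of "- r" "- \<rho>" "- s" "1 - u" u] by auto
    then show "w \<in> ball 0 R - cball 0 \<rho>" using n assms by auto
  qed
qed auto

lemma joukowski_comp_holomorphic:
  assumes "g holomorphic_on ellipse_dom \<rho>" "0 < \<rho>"
  shows "(\<lambda>w. g (w + 1 / w)) holomorphic_on {w. \<rho> < norm w \<and> norm w < 1 / \<rho>}"
proof -
  have "g \<circ> (\<lambda>w. w + 1 / w) holomorphic_on {w. \<rho> < norm w \<and> norm w < 1 / \<rho>}"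
  proof (rule holomorphic_on_compose_gen[OF _ assms(1)])
    show "(\<lambda>w. w + 1 / w) holomorphic_on {w. \<rho> < norm w \<and> norm w < 1 / \<rho>}"
      by (intro holomorphic_intros) (use assms in auto)
  qed (use assms joukowski_mem_ellipse_dom in auto)
  then show ?thesis by (simp add: o_def)
qed

text \<open>Between \<open>\<rho>\<close> and \<open>1 / AW_radius a b c\<close> no factor of the
  denominator vanishes, so Cauchy's theorem moves the circle.\<close>

lemma AW_integral_radius_indep:
  assumes g: "g holomorphic_on ellipse_dom \<rho>" "0 < \<rho>"
    and r: "\<rho> < r" "r < 1 / AW_radius a b c" and s: "\<rho> < s" "s < 1 / AW_radius a b c"
  shows "AW_integral a b c g r = AW_integral a b c g s"
proof -
  let ?R = "1 / AW_radius a b c"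
  let ?S = "ball (0::complex) ?R - cball 0 \<rho>"
  have S: "\<rho> < norm w" "norm w < 1 / \<rho>" "w \<noteq> 0" "norm w * norm a < 1" "norm w * norm b < 1" "norm w * norm c < 1"
    if "w \<in> ?S" for w
  proof -
    have w: "\<rho> < norm w" "norm w < ?R" using that by auto
    have "0 < norm w" using w g(2) by linarith
    from iffD1[OF less_inverse_AW_radius_iff[OF this] w(2)]
    have "norm w < 1 \<and> norm w * norm a < 1 \<and> norm w * norm b < 1 \<and> norm w * norm c < 1" .
    moreover have "norm w < 1 / \<rho>"
      using w calculation g(2) by (intro less_trans[of "norm w" 1 "1 / \<rho>"]) auto
    ultimately show "\<rho> < norm w" "norm w < 1 / \<rho>" "w \<noteq> 0" "norm w * norm a < 1" "norm w * norm b < 1" "norm w * norm c < 1"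
      using w g(2) by auto
  qed
  have "(\<lambda>w. g (w + 1 / w)) holomorphic_on ?S"
    by (rule holomorphic_on_subset[OF joukowski_comp_holomorphic[OF g]]) (use S in blast)
  then have "(\<lambda>w. g (w + 1 / w) * (1 - w\<^sup>2) * (1 - a * b * c * w)
             / (w * (1 - a * w) * (1 - b * w) * (1 - c * w))) holomorphic_on ?S"
    by (intro holomorphic_intros) (use S one_minus_mult_nonzero in auto)
  then show ?thesis
    unfolding AW_integral_def
    using Cauchy_theorem_homotopic_loops[OF circlepath_annulus_homotopic, of \<rho> r ?R s] assms
    by (simp add: open_Diff)
qed

text \<open>Both extensions agree on the segment from -2 to 2, which lies in every closed ellipse
  and has a limit point; the identity theorem does the rest.\<close>

lemma analytic_ext_unique:
  assumes "analytic_ext r f \<rho> g" "analytic_ext r f \<rho>' g'" "r \<le> 1" "x \<in> ellipse_dom (max \<rho> \<rho>')"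
  shows "g x = g' x"
proof -
  let ?D = "ellipse_dom (max \<rho> \<rho>')" and ?I = "complex_of_real ` {-2..2}"
  have pos: "0 < max \<rho> \<rho>'" "max \<rho> \<rho>' < 1" using assms by (auto simp: analytic_ext_def)
  have "g analytic_on ?D" "g' analytic_on ?D"
    using assms ellipse_dom_mono[of \<rho> "max \<rho> \<rho>'"] ellipse_dom_mono[of \<rho>' "max \<rho> \<rho>'"]
    by (auto simp: analytic_ext_def intro: analytic_on_subset)
  then have h: "(\<lambda>x. g x - g' x) holomorphic_on ?D"
    by (intro holomorphic_intros analytic_imp_holomorphic)
  have I: "?I \<subseteq> ?D" using pos segment_subset_ellipse_dom by simp
  have lim: "0 islimpt ?I"
    unfolding islimpt_approachable
  proof (intro allI impI)
    fix e :: real assume "0 < e"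
    then show "\<exists>z\<in>?I. z \<noteq> 0 \<and> dist z 0 < e"
      by (intro bexI[of _ "complex_of_real (min (e / 2) 1)"]) (auto simp: min_def)
  qed
  have "(\<lambda>x. g x - g' x) x = 0"
  proof (rule analytic_continuation[OF h open_ellipse_dom connected_ellipse_dom I _ lim])
    show "g z - g' z = 0" if "z \<in> ?I" for z
      using subsetD[OF segment_subset_ellipse_cdom[OF assms(3)] that] assms(1,2)
      by (simp add: analytic_ext_def)
  qed (use pos assms I in auto)
  then show ?thesis by simp
qed

text \<open>A function analytic on the larger ellipse is its own extension. Any competing extension
  agrees with it on the smaller of the two ellipses and hence gives the same integral.\<close>

lemma AW_functional_eq_integral:
  assumes g: "g analytic_on ellipse_dom \<rho>" "0 < \<rho>" and r: "\<rho> < r" "r < 1 / AW_radius a b c"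
  shows "AW_functional a b c g = AW_integral a b c g r"
proof -
  let ?R = "1 / AW_radius a b c"
  have R: "?R \<le> 1" using AW_radius_ge_1[of a b c] by simp
  have ext: "analytic_ext ?R g \<rho> g"
    using g r by (simp add: analytic_ext_def)
  have hol: "g holomorphic_on ellipse_dom \<rho>" using g(1) by (rule analytic_imp_holomorphic)
  show ?thesis
    unfolding AW_functional_def
  proof (rule the_equality)
    have "AW_integral a b c g r = AW_integral a b c g s" if "s \<in> {\<rho><..<?R}" for s
      using AW_integral_radius_indep[OF hol g(2) r, of s] that by simp
    with ext show "\<exists>\<rho>' h. analytic_ext ?R g \<rho>' h \<and>
        (\<forall>\<rho>\<in>{\<rho>'<..<?R}. AW_integral a b c g r = AW_integral a b c h \<rho>)"
      by blast
  next
    fix v assume "\<exists>\<rho>' h. analytic_ext ?R g \<rho>' h \<and> (\<forall>\<rho>\<in>{\<rho>'<..<?R}. v = AW_integral a b c h \<rho>)"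
    then obtain \<rho>' h where h: "analytic_ext ?R g \<rho>' h" "\<And>s. s \<in> {\<rho>'<..<?R} \<Longrightarrow> v = AW_integral a b c h s"
      by blast
    \<comment> \<open>A radius above both \<open>\<rho>\<close> and \<open>\<rho>'\<close>, so that
      the circle is mapped to where \<open>h\<close> and \<open>g\<close> coincide.\<close>
    define s where "s = (max \<rho> \<rho>' + ?R) / 2"
    have s: "max \<rho> \<rho>' < s" "s < ?R" using h(1) r by (auto simp: s_def analytic_ext_def)
    have "AW_integral a b c h s = AW_integral a b c g s"
      unfolding AW_integral_def
    proof (intro arg_cong2[where f = "(*)"] refl contour_integral_eq)
      fix w assume "w \<in> path_image (circlepath 0 s)"
      then have w: "norm w = s" using s g(2) by simp
      have "w + 1 / w \<in> ellipse_dom (max \<rho> \<rho>')"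
        using s R w unfolding ellipse_dom_def by (intro CollectI exI[of _ w]) auto
      then have "h (w + 1 / w) = g (w + 1 / w)"
        using analytic_ext_unique[OF h(1) ext R] by (simp add: max.commute)
      then show "h (w + 1 / w) * (1 - w\<^sup>2) * (1 - a * b * c * w) / (w * (1 - a * w) * (1 - b * w) * (1 - c * w)) =
          g (w + 1 / w) * (1 - w\<^sup>2) * (1 - a * b * c * w) / (w * (1 - a * w) * (1 - b * w) * (1 - c * w))"
        by simp
    qed
    moreover have "AW_integral a b c g s = AW_integral a b c g r"
      using AW_integral_radius_indep[OF hol g(2), of s a b c r] s r by simp
    ultimately show "v = AW_integral a b c g r" using h(2)[of s] s by simp
  qed
qed

lemma frak_h_joukowski: "w \<noteq> 0 \<Longrightarrow> frak_h \<alpha> (w + 1 / w) = (1 - \<alpha> * w) * (1 - \<alpha> / w)"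
  by (simp add: frak_h_def field_simps power2_eq_square)

lemma frak_h_joukowski_nonzero:
  assumes "norm \<alpha> < norm w" "norm w \<le> 1"
  shows "frak_h \<alpha> (w + 1 / w) \<noteq> 0"
proof -
  have w: "w \<noteq> 0" using assms by auto
  have "norm w * norm \<alpha> < 1"
    using assms mult_left_le[of "norm w" "norm \<alpha>"] by (simp add: mult.commute)
  then have "1 - \<alpha> * w \<noteq> 0" by (rule one_minus_mult_nonzero)
  moreover have "1 - \<alpha> / w \<noteq> 0" using assms w by auto
  ultimately show ?thesis using w by (simp add: frak_h_joukowski)
qed

lemma frak_h_nonzero:
  assumes "0 < \<rho>" "x \<in> ellipse_dom \<rho>" "norm \<alpha> \<le> \<rho>"
  shows "frak_h \<alpha> x \<noteq> 0"
  using frak_h_joukowski_nonzero[of \<alpha> "frak_u x"] norm_frak_u_gt[OF assms(1,2)] assms(3)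
  by (simp add: frak_u_root norm_frak_u_le)

lemma norm_frak_u_joukowski:
  assumes "w \<noteq> 0" "norm w < 1"
  shows "norm (frak_u (w + 1 / w)) = norm w"
proof -
  let ?u = "frak_u (w + 1 / w)"
  have "?u = w \<or> ?u * w = 1"
    using joukowski_eq_iff[of ?u w] frak_u_root[of "w + 1 / w"] frak_u_nonzero assms by simp
  moreover have "?u * w \<noteq> 1"
  proof
    assume "?u * w = 1"
    then have "1 = norm ?u * norm w" by (metis norm_mult norm_one)
    also have "\<dots> \<le> 1 * norm w" using norm_frak_u_le by (intro mult_right_mono) auto
    finally show False using assms by simp
  qed
  ultimately show ?thesis by auto
qed

section \<open>Transition functionals as integrals depending analytically on the starting
  point\<close>

lemma frak_h_integral_holomorphic:
  assumes k: "continuous_on (sphere 0 r) k" and "0 < r" and U: "convex U"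
    and nz: "\<And>x v. x \<in> U \<Longrightarrow> norm v = r \<Longrightarrow> frak_h (c * v) x \<noteq> 0"
  shows "(\<lambda>x. contour_integral (circlepath 0 r) (\<lambda>v. k v / frak_h (c * v) x)) holomorphic_on U"
proof -
  let ?p = "circlepath 0 r" and ?d = "\<lambda>\<theta>::real. 2 * pi * \<i> * r * exp (2 * of_real pi * \<i> * \<theta>)"
  let ?f = "\<lambda>x \<theta>. k (?p \<theta>) / frak_h (c * ?p \<theta>) x * ?d \<theta>"
  let ?f' = "\<lambda>x \<theta>. k (?p \<theta>) * (c * ?p \<theta>) / (frak_h (c * ?p \<theta>) x)\<^sup>2 * ?d \<theta>"
  have p: "norm (?p \<theta>) = r" for \<theta>
    using \<open>0 < r\<close> by (simp add: circlepath norm_mult)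
  have pc: "continuous_on A ?p" for A
    unfolding circlepath by (intro continuous_intros)
  have kc: "continuous_on A (\<lambda>\<theta>. k (?p \<theta>))" for A
    by (rule continuous_on_compose2[OF k pc]) (use p in auto)
  have nz': "1 + (c * ?p \<theta>)\<^sup>2 - c * ?p \<theta> * x \<noteq> 0" if "x \<in> U" for x \<theta>
    using nz[OF that p] by (simp add: frak_h_def)
  have "(\<lambda>x. integral (cbox 0 1) (?f x)) holomorphic_on U"
  proof (rule leibniz_rule_holomorphic[where fx = ?f'])
    show "((\<lambda>x. ?f x \<theta>) has_field_derivative ?f' x \<theta>) (at x within U)"
      if "x \<in> U" "\<theta> \<in> cbox 0 1" for x \<theta>
      unfolding frak_h_def
      by (rule derivative_eq_intros refl nz'[OF that(1)])+ (simp add: power2_eq_square)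
    show "?f x integrable_on cbox 0 1" if "x \<in> U" for x
      unfolding frak_h_def
      by (intro integrable_continuous continuous_intros kc pc) (use nz'[OF that] in auto)
    have s: "continuous_on A (\<lambda>z. ?p (snd z))" for A :: "(complex \<times> real) set"
      by (rule continuous_on_compose2[OF pc[of UNIV]]) (auto intro: continuous_intros)
    have ks: "continuous_on A (\<lambda>z. k (?p (snd z)))" for A :: "(complex \<times> real) set"
      by (rule continuous_on_compose2[OF kc[of UNIV]]) (auto intro: continuous_intros)
    show "continuous_on (U \<times> cbox 0 1) (\<lambda>(x, \<theta>). ?f' x \<theta>)"
      unfolding frak_h_def case_prod_beta
      by (intro continuous_intros s ks) (use nz' in auto)
  qed (use U in auto)
  then show ?thesis
    by (simp add: contour_integral_integral vector_derivative_circlepath)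
qed

text \<open>The factor of the integrand that is free of \<open>x\<close>: the product of the three
  parameters is \<open>c2 * s\<^sup>2 / t\<close>, and \<open>x\<close> enters through the
  denominator \<open>frak_h (of_real (s / t) * v) x\<close> alone.\<close>

definition transition_kernel :: "real \<Rightarrow> real \<Rightarrow> real \<Rightarrow> complex \<Rightarrow> complex" where
  "transition_kernel c2 s t v =
     (1 - v\<^sup>2) * (1 - of_real (c2 * s\<^sup>2 / t) * v) / (v * (1 - of_real (c2 * t) * v))"

lemma AW_transition_eq:
  assumes c2: "0 \<le> c2" and s: "0 < s" "s \<le> t"
    and g: "g analytic_on ellipse_dom \<rho>" "0 < \<rho>"
    and r: "\<rho> < r" "r < 1" "r * (c2 * t) < 1" "s * r < t * norm (frak_u x)"
  shows "AW_transition c2 s t x g = 1 / (2 * of_real pi * \<i>) *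
    contour_integral (circlepath 0 r)
      (\<lambda>v. g (v + 1 / v) * transition_kernel c2 s t v / frak_h (of_real (s / t) * v) x)"
proof -
  define u where "u = frak_u x"
  have u: "u \<noteq> 0" "u + 1 / u = x" "norm u \<le> 1"
    using frak_u_nonzero frak_u_root norm_frak_u_le by (auto simp: u_def)
  let ?a = "complex_of_real (c2 * t)" and ?b = "of_real s * u / of_real t" and ?c = "of_real s / (of_real t * u)"
  have t: "0 < t" using s by simp
  have "r * (s * norm u / t) < 1"
  proof -
    have "s * norm u \<le> t * 1" using s u by (intro mult_mono) auto
    then have "s * norm u / t \<le> 1" using t by (simp add: field_simps)
    then have "r * (s * norm u / t) \<le> r * 1" using r g by (intro mult_left_mono) auto
    then show ?thesis using r by simp
  qed
  \<comment> \<open>The parameter \<open>?c\<close> contains \<open>1 / u\<close>, which may be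
    large; the hypothesis on \<open>norm (frak_u x)\<close> keeps its pole outside the
    circle.\<close>
  moreover have "r * (s / (t * norm u)) < 1" using r u t by (simp add: u_def field_simps)
  ultimately have R: "r < 1 / AW_radius ?a ?b ?c"
    using r g c2 s t by (subst less_inverse_AW_radius_iff) (auto simp: norm_mult norm_divide)
  have "AW_transition c2 s t x g = AW_integral ?a ?b ?c g r"
    unfolding AW_transition_def u_def[symmetric]
    by (rule AW_functional_eq_integral[OF g r(1) R])
  also have "\<dots> = 1 / (2 * of_real pi * \<i>) *
    contour_integral (circlepath 0 r)
      (\<lambda>v. g (v + 1 / v) * transition_kernel c2 s t v / frak_h (of_real (s / t) * v) x)"
    unfolding AW_integral_def
  proof (intro arg_cong2[where f = "(*)"] refl contour_integral_eq)
    fix v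
    have "?a * ?b * ?c = of_real (c2 * s\<^sup>2 / t)"
      using u t by (simp add: power2_eq_square)
    moreover have "(1 - ?b * v) * (1 - ?c * v) = frak_h (of_real (s / t) * v) x"
      unfolding u(2)[symmetric] frak_h_joukowski[OF u(1)] using t by simp
    ultimately show "g (v + 1 / v) * (1 - v\<^sup>2) * (1 - ?a * ?b * ?c * v) / (v * (1 - ?a * v) * (1 - ?b * v) * (1 - ?c * v))
      = g (v + 1 / v) * transition_kernel c2 s t v / frak_h (of_real (s / t) * v) x"
      by (simp add: transition_kernel_def mult.assoc)
  qed
  finally show ?thesis .
qed

lemma joukowski_comp_continuous_sphere:
  assumes "g analytic_on ellipse_dom \<rho>" "0 < \<rho>" "\<rho> < r" "r < 1"
  shows "continuous_on (sphere 0 r) (\<lambda>w. g (w + 1 / w))"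
proof (rule continuous_on_subset[OF holomorphic_on_imp_continuous_on])
  show "(\<lambda>w. g (w + 1 / w)) holomorphic_on {w. \<rho> < norm w \<and> norm w < 1 / \<rho>}"
    by (rule joukowski_comp_holomorphic) (use assms in \<open>auto simp: analytic_imp_holomorphic\<close>)
  have "r * \<rho> < 1" using assms mult_strict_mono[of r 1 \<rho> 1] by simp
  then show "sphere 0 r \<subseteq> {w. \<rho> < norm w \<and> norm w < 1 / \<rho>}"
    using assms by (auto simp: field_simps)
qed

lemma transition_kernel_continuous:
  assumes "0 \<le> c2" "0 < t" "0 < r" "r * (c2 * t) < 1"
  shows "continuous_on (sphere 0 r) (transition_kernel c2 s t)"
  unfolding transition_kernel_def
  by (intro continuous_intros)
    (use assms one_minus_mult_nonzero[of _ "of_real (c2 * t)"] in \<open>auto simp: norm_mult\<close>)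

text \<open>The branch \<open>frak_u\<close> jumps across the segment, so analyticity is read off
  the integral formula, which involves \<open>x\<close> through \<open>frak_h\<close>. The
  admissible radius depends on \<open>x\<close>, hence the argument is local.\<close>

lemma AW_transition_analytic:
  assumes "0 < a" "0 < s" "s \<le> t" "0 < c2" "a * t < 1" "a * t\<^sup>2 * c2 < 1"
    and g: "g analytic_on ellipse_dom (a * t)"
  shows "(\<lambda>x. AW_transition c2 s t x g) analytic_on ellipse_dom (a * s)"
  unfolding analytic_on_def
proof
  fix x0 assume x0: "x0 \<in> ellipse_dom (a * s)"
  have t: "0 < t" using assms by simp
  let ?u = "frak_u x0"
  have u: "a * s < norm ?u" using x0 assms by (intro norm_frak_u_gt) auto
  \<comment> \<open>On a ball inside \<open>ellipse_dom \<rho>\<close> all values of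
    \<open>frak_u\<close> have norm above \<open>\<rho>\<close>, so one radius \<open>r\<close>
    serves the whole ball.\<close>
  then obtain \<rho> where \<rho>: "a * s < \<rho>" "\<rho> < norm ?u" using dense by blast
  have \<rho>0: "0 < \<rho>" using \<rho> assms by (smt (verit) mult_pos_pos)
  have "x0 \<in> ellipse_dom \<rho>"
    unfolding ellipse_dom_def using \<rho> by (intro CollectI exI[of _ ?u]) (simp add: frak_u_root norm_frak_u_le)
  then obtain e where e: "e > 0" "ball x0 e \<subseteq> ellipse_dom \<rho>"
    using open_ellipse_dom[OF \<rho>0] open_contains_ball by blast
  \<comment> \<open>The bound \<open>t * \<rho> / s\<close> keeps \<open>frak_h\<close> away from
    zero on the ball, and \<open>1 / (c2 * t)\<close> keeps the pole of the kernel outside.\<close>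
  have "a * t < min (min 1 (t * \<rho> / s)) (1 / (c2 * t))"
    using assms \<rho> t by (auto simp: field_simps power2_eq_square)
  then obtain r where r: "a * t < r" "r < 1" "r < t * \<rho> / s" "r < 1 / (c2 * t)"
    by (meson dense min_less_iff_conj)
  have at: "0 < a * t" using assms t by simp
  have r': "r * (c2 * t) < 1" "s * r < t * \<rho>"
    using r(3,4) assms t by (auto simp: field_simps)
  have r0: "0 < r" using at r(1) by linarith
  have "(\<lambda>x. 1 / (2 * of_real pi * \<i>) * contour_integral (circlepath 0 r)
      (\<lambda>v. g (v + 1 / v) * transition_kernel c2 s t v / frak_h (of_real (s / t) * v) x)) holomorphic_on ball x0 e"
  proof (intro holomorphic_intros frak_h_integral_holomorphic)
    show "continuous_on (sphere 0 r) (\<lambda>v. g (v + 1 / v) * transition_kernel c2 s t v)"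
      by (intro continuous_intros joukowski_comp_continuous_sphere[OF g at] transition_kernel_continuous)
        (use r r' r0 assms t in auto)
    show "frak_h (of_real (s / t) * v) x \<noteq> 0" if "x \<in> ball x0 e" "norm v = r" for x v
    proof (rule frak_h_nonzero[OF \<rho>0])
      show "norm (of_real (s / t) * v) \<le> \<rho>"
        using r' assms t that by (simp add: norm_mult norm_divide field_simps)
    qed (use that e in auto)
  qed (use r0 in auto)
  moreover have "AW_transition c2 s t x g = 1 / (2 * of_real pi * \<i>) * contour_integral (circlepath 0 r)
      (\<lambda>v. g (v + 1 / v) * transition_kernel c2 s t v / frak_h (of_real (s / t) * v) x)"
    if "x \<in> ball x0 e" for x
  proof (rule AW_transition_eq[OF less_imp_le[OF assms(4)] assms(2,3) g at r(1,2) r'(1)])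
    have "\<rho> < norm (frak_u x)" using norm_frak_u_gt[OF \<rho>0] that e by auto
    then have "t * \<rho> < t * norm (frak_u x)" using t by simp
    with r' show "s * r < t * norm (frak_u x)" by linarith
  qed
  ultimately have "(\<lambda>x. AW_transition c2 s t x g) holomorphic_on ball x0 e"
    by (rule holomorphic_transform[OF _ sym])
  then show "\<exists>e>0. (\<lambda>x. AW_transition c2 s t x g) holomorphic_on ball x0 e"
    using e by blast
qed

section \<open>Exchanging the contour integrals\<close>

text \<open>No integrability is assumed: for \<open>c \<noteq> 0\<close> both integrands fail
  together, and then both integrals have the default value 0.\<close>

lemma contour_integral_cmult:
  "contour_integral \<gamma> (\<lambda>x. c * f x) = c * contour_integral \<gamma> f"
proof (cases "c = 0 \<or> f contour_integrable_on \<gamma>")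
  case True
  then show ?thesis by (auto simp: contour_integral_lmul)
next
  case False
  then show ?thesis
    by (simp add: contour_integrable_lmul_iff not_integrable_contour_integral)
qed

text \<open>Partial fractions reduce the integral to two instances of Cauchy's formula.\<close>

lemma contour_integral_two_poles:
  assumes \<phi>: "\<phi> holomorphic_on cball 0 r" and "norm \<alpha> < r" "norm \<gamma> < r" "\<alpha> \<noteq> \<gamma>"
  shows "contour_integral (circlepath 0 r) (\<lambda>w. \<phi> w / ((w - \<alpha>) * (w - \<gamma>))) =
    2 * of_real pi * \<i> * ((\<phi> \<alpha> - \<phi> \<gamma>) / (\<alpha> - \<gamma>))"
proof -
  have C: "((\<lambda>w. \<phi> w / (w - z)) has_contour_integral (2 * of_real pi * \<i> * \<phi> z)) (circlepath 0 r)"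
    if "norm z < r" for z
    by (rule Cauchy_integral_circlepath)
      (use \<phi> that in \<open>auto intro: holomorphic_on_imp_continuous_on holomorphic_on_subset\<close>)
  have "((\<lambda>w. (\<phi> w / (w - \<alpha>) - \<phi> w / (w - \<gamma>)) / (\<alpha> - \<gamma>)) has_contour_integral
      (2 * of_real pi * \<i> * \<phi> \<alpha> - 2 * of_real pi * \<i> * \<phi> \<gamma>) / (\<alpha> - \<gamma>)) (circlepath 0 r)"
    by (intro has_contour_integral_div has_contour_integral_diff C assms)
  then have "contour_integral (circlepath 0 r) (\<lambda>w. (\<phi> w / (w - \<alpha>) - \<phi> w / (w - \<gamma>)) / (\<alpha> - \<gamma>)) =
      (2 * of_real pi * \<i> * \<phi> \<alpha> - 2 * of_real pi * \<i> * \<phi> \<gamma>) / (\<alpha> - \<gamma>)"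
    by (rule contour_integral_unique)
  moreover have "contour_integral (circlepath 0 r) (\<lambda>w. \<phi> w / ((w - \<alpha>) * (w - \<gamma>))) =
      contour_integral (circlepath 0 r) (\<lambda>w. (\<phi> w / (w - \<alpha>) - \<phi> w / (w - \<gamma>)) / (\<alpha> - \<gamma>))"
  proof (rule contour_integral_eq)
    fix w assume "w \<in> path_image (circlepath 0 r)"
    then have "w - \<alpha> \<noteq> 0" "w - \<gamma> \<noteq> 0" using assms by auto
    moreover have "\<alpha> - \<gamma> \<noteq> 0" using assms by simp
    moreover have "p / (x * y) = (p / x - p / y) / d" if "x \<noteq> 0" "y \<noteq> 0" "d \<noteq> 0" "y - x = d"
      for p x y d :: complex
      using that(1-3) by (simp add: field_simps flip: that(4))
    ultimately show "\<phi> w / ((w - \<alpha>) * (w - \<gamma>)) = (\<phi> w / (w - \<alpha>) - \<phi> w / (w - \<gamma>)) / (\<alpha> - \<gamma>)"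
      by simp
  qed
  ultimately show ?thesis by (simp add: algebra_simps)
qed

text \<open>With \<open>H y = 1 / (1 - c1 * y)\<close> this is the marginal at time
  \<open>t\<close>; a general \<open>H\<close> carries the weights collected at earlier
  times.\<close>

definition weighted_functional ::
    "real \<Rightarrow> real \<Rightarrow> (complex \<Rightarrow> complex) \<Rightarrow> (complex \<Rightarrow> complex) \<Rightarrow> real \<Rightarrow> complex" where
  "weighted_functional c2 t H g r = 1 / (2 * of_real pi * \<i>) * contour_integral (circlepath 0 r)
     (\<lambda>w. g (w + 1 / w) * ((1 - w\<^sup>2) / (w * (1 - of_real (c2 * t) * w)) * H (w / of_real t)))"

lemma layer_gf_rescaled_holomorphic:
  assumes "geo_bounded q W" "0 < q" "0 < t" "r * q < t"
  shows "(\<lambda>w. layer_gf W (w / of_real t)) holomorphic_on cball 0 r"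
proof -
  have "layer_gf W \<circ> (\<lambda>w. w / of_real t) holomorphic_on cball 0 r"
  proof (rule holomorphic_on_compose_gen[OF _ layer_gf_holomorphic[OF assms(1,2)]])
    show "(\<lambda>w::complex. w / of_real t) ` cball 0 r \<subseteq> ball 0 (1 / q)"
    proof (intro image_subsetI)
      fix w :: complex assume "w \<in> cball 0 r"
      then have "norm w * q \<le> r * q" using assms by (intro mult_right_mono) auto
      also note assms(4)
      finally show "w / of_real t \<in> ball 0 (1 / q)"
        using assms by (simp add: norm_divide field_simps)
    qed
  qed (use assms in \<open>auto intro!: holomorphic_intros\<close>)
  then show ?thesis by (simp add: o_def)
qed

text \<open>At the two poles \<open>w / s\<close> equals \<open>a\<close> and \<open>v / t\<close>,
  so the residues contain the two values of \<open>layer_gf W\<close> in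
  \<open>layer_gf_layer_step\<close>. The bound \<open>s * norm v < t * r\<close> puts the second
  pole inside the circle.\<close>

lemma weighted_functional_inner:
  assumes W: "geo_bounded q W" "0 < q" and a: "0 < a" "a * q < 1" and s: "0 < s" "0 < t" and c2: "0 < c2"
    and b: "a * s\<^sup>2 < q" "a * s\<^sup>2 * c2 < 1"
    and r: "a * s < r" "r < 1" "r * (c2 * s) < 1" "r * q < s"
    and v: "a * t < norm v" "norm v < 1" "s * norm v < t * r" "norm v * (c2 * t) < 1"
  shows "transition_kernel c2 s t v * contour_integral (circlepath 0 r)
      (\<lambda>w. (1 - w\<^sup>2) / (w * (1 - of_real (c2 * s) * w)) * layer_gf W (w / of_real s) /
        (frak_h (of_real (a * s)) (w + 1 / w) * frak_h (of_real (s / t) * v) (w + 1 / w)))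
    = 2 * of_real pi * \<i> * ((1 - v\<^sup>2) / (v * (1 - of_real (c2 * t) * v))
        * layer_gf (layer_step a c2 (a * s\<^sup>2) W) (v / of_real t))"
proof -
  \<comment> \<open>\<open>\<alpha>\<close> and \<open>\<gamma>\<close> are the only poles inside the circle: the apparent pole at \<open>0\<close> is cancelled by the
    factors \<open>1 / w\<close> of the two \<open>h\<close>'s.\<close>
  define \<alpha> where "\<alpha> = complex_of_real (a * s)"
  define y where "y = v / of_real t"
  define \<gamma> where "\<gamma> = of_real s * y"
  let ?F = "layer_gf W" and ?c = "complex_of_real (c2 * s)" and ?b = "complex_of_real (a * s\<^sup>2)"
  have r0: "0 < r" using r(1) a s by (smt (verit) mult_pos_pos)
  have \<alpha>: "norm \<alpha> < r" and \<gamma>: "norm \<gamma> < r"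
    using r v a s by (auto simp: \<alpha>_def \<gamma>_def y_def norm_mult norm_divide field_simps)
  \<comment> \<open>The lower bound on \<open>norm v\<close> keeps the two poles apart.\<close>
  have "norm \<alpha> < norm \<gamma>"
    using v a s by (auto simp: \<alpha>_def \<gamma>_def y_def norm_mult norm_divide field_simps)
  then have ne: "\<alpha> \<noteq> \<gamma>" by auto
  have small: "1 - z * w \<noteq> 0" if "norm w \<le> r" "norm z \<le> r" for w z :: complex
  proof (rule one_minus_mult_nonzero)
    have "norm w * norm z \<le> r * r" using that r0 by (intro mult_mono) auto
    also have "\<dots> < 1" using r r0 mult_strict_mono[of r 1 r 1] by simp
    finally show "norm w * norm z < 1" .
  qed
  have cs: "1 - ?c * w \<noteq> 0" if "norm w \<le> r" for w
  proof (rule one_minus_mult_nonzero)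
    have "norm w * norm ?c = norm w * (c2 * s)" using c2 s by (simp add: norm_mult)
    also have "\<dots> \<le> r * (c2 * s)" using that c2 s by (intro mult_right_mono) auto
    finally show "norm w * norm ?c < 1" using r by simp
  qed
  \<comment> \<open>Each \<open>h\<close> contributes a factor \<open>w\<close> to the numerator;
    one of the two cancels against the \<open>w\<close> in the denominator of the kernel.\<close>
  define \<phi> where "\<phi> = (\<lambda>w. w * (1 - w\<^sup>2) * ?F (w / of_real s) / ((1 - \<alpha> * w) * (1 - \<gamma> * w) * (1 - ?c * w)))"
  have \<phi>: "\<phi> holomorphic_on cball 0 r"
    unfolding \<phi>_def
    by (intro holomorphic_intros layer_gf_rescaled_holomorphic[OF W s(1) r(4)])
      (use small cs \<alpha> \<gamma> in auto)
  have "contour_integral (circlepath 0 r)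
      (\<lambda>w. (1 - w\<^sup>2) / (w * (1 - ?c * w)) * ?F (w / of_real s) /
        (frak_h \<alpha> (w + 1 / w) * frak_h \<gamma> (w + 1 / w))) =
     contour_integral (circlepath 0 r) (\<lambda>w. \<phi> w / ((w - \<alpha>) * (w - \<gamma>)))"
  proof (rule contour_integral_eq)
    fix w assume "w \<in> path_image (circlepath 0 r)"
    then have w: "norm w = r" using r0 by simp
    then have w0: "w \<noteq> 0" using r0 by auto
    have nz: "w - \<alpha> \<noteq> 0" "w - \<gamma> \<noteq> 0" "1 - \<alpha> * w \<noteq> 0" "1 - \<gamma> * w \<noteq> 0" "1 - ?c * w \<noteq> 0"
      using w \<alpha> \<gamma> small cs by auto
    have h: "frak_h z (w + 1 / w) = (1 - z * w) * (w - z) / w" for z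
      unfolding frak_h_joukowski[OF w0] using w0 by (simp add: field_simps)
    show "(1 - w\<^sup>2) / (w * (1 - ?c * w)) * ?F (w / of_real s) /
        (frak_h \<alpha> (w + 1 / w) * frak_h \<gamma> (w + 1 / w)) = \<phi> w / ((w - \<alpha>) * (w - \<gamma>))"
      unfolding h \<phi>_def using nz w0 by (simp add: divide_simps)
  qed
  also have "\<dots> = 2 * of_real pi * \<i> * ((\<phi> \<alpha> - \<phi> \<gamma>) / (\<alpha> - \<gamma>))"
    by (rule contour_integral_two_poles[OF \<phi> \<alpha> \<gamma> ne])
  finally have I: "contour_integral (circlepath 0 r)
      (\<lambda>w. (1 - w\<^sup>2) / (w * (1 - ?c * w)) * ?F (w / of_real s) /
        (frak_h \<alpha> (w + 1 / w) * frak_h \<gamma> (w + 1 / w))) = 2 * of_real pi * \<i> * ((\<phi> \<alpha> - \<phi> \<gamma>) / (\<alpha> - \<gamma>))" .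
  have sc: "complex_of_real s \<noteq> 0" using s by simp
  have b1: "1 - \<alpha> * \<gamma> = 1 - ?b * y" by (simp add: \<alpha>_def \<gamma>_def power2_eq_square mult_ac)
  have sq: "1 - \<alpha>\<^sup>2 \<noteq> 0" "1 - \<gamma>\<^sup>2 \<noteq> 0"
    using small[of \<alpha> \<alpha>] small[of \<gamma> \<gamma>] \<alpha> \<gamma> by (auto simp: power2_eq_square)
  have b0: "1 - ?b * y \<noteq> 0" using small[of \<gamma> \<alpha>] \<alpha> \<gamma> b1 by auto
  have d1: "1 - ?c * \<gamma> \<noteq> 0" "1 - ?c * \<alpha> \<noteq> 0" using cs \<alpha> \<gamma> by auto
  \<comment> \<open>At a pole, \<open>1 - w\<^sup>2\<close> cancels against one of the factors
    \<open>1 - \<alpha> * w\<close>, \<open>1 - \<gamma> * w\<close>; the other one becomes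
    \<open>1 - \<alpha> * \<gamma>\<close>.\<close>
  have \<phi>\<alpha>: "\<phi> \<alpha> = \<alpha> * ?F (of_real a) / ((1 - ?b * y) * (1 - ?c * \<alpha>))"
    using sq(1) sc unfolding \<phi>_def b1[symmetric] by (simp add: power2_eq_square \<alpha>_def mult_ac)
  have \<phi>\<gamma>: "\<phi> \<gamma> = \<gamma> * ?F y / ((1 - ?b * y) * (1 - ?c * \<gamma>))"
    using sq(2) sc unfolding \<phi>_def b1[symmetric] by (simp add: power2_eq_square \<gamma>_def mult_ac)
  have "norm y * q < 1"
  proof -
    have "(s * norm v) * q < (t * r) * q" using v W by (intro mult_strict_right_mono) auto
    also have "\<dots> < t * s" using r s by (simp add: mult.assoc)
    finally show ?thesis using s by (simp add: y_def norm_divide field_simps)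
  qed
  then have step: "(y - of_real a) * (1 - ?b * y) * layer_gf (layer_step a c2 (a * s\<^sup>2) W) y =
    y * ?F y - ?F (of_real a) * (of_real a - of_real (a * s\<^sup>2 * c2) * y) / (1 - of_real (a * s\<^sup>2 * c2))"
    using W a b by (intro layer_gf_layer_step) auto
  have e1: "1 - complex_of_real (a * s\<^sup>2 * c2) = 1 - ?c * \<alpha>"
    by (simp add: \<alpha>_def power2_eq_square mult_ac)
  have e2: "of_real a - complex_of_real (a * s\<^sup>2 * c2) * y = of_real a * (1 - ?c * \<gamma>)"
    by (simp add: \<gamma>_def power2_eq_square algebra_simps)
  have ya: "\<alpha> - \<gamma> = - (of_real s * (y - of_real a))" "y - of_real a \<noteq> 0"
    using ne sc by (auto simp: \<alpha>_def \<gamma>_def algebra_simps)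
  let ?L = "layer_gf (layer_step a c2 (a * s\<^sup>2) W) y"
  have L: "?L = (y * ?F y - ?F (of_real a) * (of_real a * (1 - ?c * \<gamma>)) / (1 - ?c * \<alpha>))
      / ((y - of_real a) * (1 - ?b * y))"
    using step b0 ya(2) unfolding e1 e2 mult.commute[of _ ?L]
    by (intro nonzero_eq_divide_eq[THEN iffD2]) auto
  have \<alpha>s: "\<alpha> = of_real s * of_real a" by (simp add: \<alpha>_def)
  have alg: "(1 - C) * ((s * a * fa / (B * D) - s * y * fy / (B * (1 - C))) / (- (s * Y)))
      = (y * fy - fa * (a * (1 - C)) / D) / (Y * B)"
    if "1 - C \<noteq> 0" "B \<noteq> 0" "D \<noteq> 0" "Y \<noteq> 0" "s \<noteq> 0" for C s a fa B D y fy Y :: complex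
    using that by (simp add: divide_simps) (simp add: algebra_simps)
  have key: "(1 - ?c * \<gamma>) * ((\<phi> \<alpha> - \<phi> \<gamma>) / (\<alpha> - \<gamma>)) = ?L"
    unfolding \<phi>\<alpha> \<phi>\<gamma> ya(1) L
    using alg[OF d1(1) b0 d1(2) ya(2) sc, of "of_real a" "?F (of_real a)" y "?F y"]
    by (simp only: \<alpha>s \<gamma>_def)
  \<comment> \<open>The transition kernel is the marginal kernel at time \<open>t\<close> times
    \<open>1 - ?c * \<gamma>\<close>, the factor that cancels the denominator of
    \<open>\<phi> \<gamma>\<close>.\<close>
  have k: "transition_kernel c2 s t v = (1 - v\<^sup>2) / (v * (1 - of_real (c2 * t) * v)) * (1 - ?c * \<gamma>)"
    by (simp add: transition_kernel_def \<gamma>_def y_def power2_eq_square mult_ac)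
  have \<gamma>v: "of_real (s / t) * v = \<gamma>" by (simp add: \<gamma>_def y_def)
  show ?thesis
    unfolding \<gamma>v \<alpha>_def[symmetric] I k y_def[symmetric] key[symmetric] by (simp only: mult_ac)
qed

text \<open>Insert the integral for the transition, swap the two circles and evaluate the integral
  over \<open>w\<close> by \<open>weighted_functional_inner\<close>. Since
  \<open>frak_u (w + 1 / w)\<close> has norm \<open>r\<close>, the condition
  \<open>s * r' < t * r\<close> validates the transition formula and keeps the integrand continuous
  on the product of the circles.\<close>

lemma weighted_functional_step:
  assumes W: "geo_bounded q W" "0 < q" and a: "0 < a" "a * q < 1" and s: "0 < s" "s \<le> t" and c2: "0 < c2"
    and b: "a * s\<^sup>2 < q" "a * s\<^sup>2 * c2 < 1"
    and r: "a * s < r" "r < 1" "r * (c2 * s) < 1" "r * q < s"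
    and r': "a * t < r'" "r' < 1" "r' * (c2 * t) < 1" "s * r' < t * r"
    and g: "g analytic_on ellipse_dom (a * t)"
  shows "weighted_functional c2 s (layer_gf W) (\<lambda>x. 1 / frak_h (of_real (a * s)) x * AW_transition c2 s t x g) r
    = weighted_functional c2 t (layer_gf (layer_step a c2 (a * s\<^sup>2) W)) g r'"
proof -
  have t: "0 < t" using s by simp
  have r0: "0 < r" using r(1) a s by (smt (verit) mult_pos_pos)
  have r'0: "0 < r'" using r'(1) a t by (smt (verit) mult_pos_pos)
  have at: "0 < a * t" using a t by simp
  let ?P = "2 * of_real pi * \<i>" and ?c = "complex_of_real (c2 * s)"
  define A where "A = (\<lambda>w. (1 - w\<^sup>2) / (w * (1 - ?c * w)) * layer_gf W (w / of_real s)
     / frak_h (of_real (a * s)) (w + 1 / w))"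
  define B where "B = (\<lambda>v. g (v + 1 / v) * transition_kernel c2 s t v)"
  define h where "h = (\<lambda>w v. frak_h (of_real (s / t) * v) (w + 1 / w))"
  have hnz: "h w v \<noteq> 0" if "norm w = r" "norm v = r'" for w v
    unfolding h_def
    by (rule frak_h_joukowski_nonzero)
      (use that r r' s t in \<open>auto simp: norm_mult norm_divide field_simps\<close>)
  have Ac: "continuous_on (sphere 0 r) A"
  proof -
    have "frak_h (of_real (a * s)) (w + 1 / w) \<noteq> 0" if "norm w = r" for w
      by (rule frak_h_joukowski_nonzero) (use that r a s in \<open>auto simp: norm_mult\<close>)
    moreover have "continuous_on (sphere 0 r) (\<lambda>w. layer_gf W (w / of_real s))"
      by (rule continuous_on_subset[OF holomorphic_on_imp_continuous_on[OF
            layer_gf_rescaled_holomorphic[OF W s(1) r(4)]]]) auto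
    moreover have "1 - ?c * w \<noteq> 0" if "norm w = r" for w
      by (rule one_minus_mult_nonzero) (use that r c2 s in \<open>auto simp: norm_mult\<close>)
    moreover have "w \<noteq> 0" if "norm w = r" for w :: complex using that r0 by auto
    ultimately show ?thesis
      unfolding A_def frak_h_def by (intro continuous_intros) auto
  qed
  have Bc: "continuous_on (sphere 0 r') B"
    unfolding B_def
    by (intro continuous_intros joukowski_comp_continuous_sphere[OF g at] transition_kernel_continuous)
      (use r' r'0 c2 t in auto)
  have cont: "continuous_on (sphere 0 r \<times> sphere 0 r') (\<lambda>(w, v). A w * B v / h w v)"
  proof -
    have "continuous_on (sphere 0 r \<times> sphere 0 r') (\<lambda>z. A (fst z))"
      by (rule continuous_on_compose2[OF Ac]) (auto intro: continuous_intros)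
    moreover have "continuous_on (sphere 0 r \<times> sphere 0 r') (\<lambda>z. B (snd z))"
      by (rule continuous_on_compose2[OF Bc]) (auto intro: continuous_intros)
    moreover have "continuous_on (sphere 0 r \<times> sphere 0 r') (\<lambda>z. h (fst z) (snd z))"
      unfolding h_def frak_h_def by (intro continuous_intros) (use r0 in auto)
    ultimately show ?thesis
      unfolding case_prod_beta by (intro continuous_intros) (use hnz in auto)
  qed
  have "weighted_functional c2 s (layer_gf W) (\<lambda>x. 1 / frak_h (of_real (a * s)) x * AW_transition c2 s t x g) r =
    1 / ?P * contour_integral (circlepath 0 r)
      (\<lambda>w. 1 / ?P * contour_integral (circlepath 0 r') (\<lambda>v. A w * B v / h w v))"
    unfolding weighted_functional_def
  proof (rule arg_cong2[where f = "(*)", OF refl contour_integral_eq])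
    fix w assume "w \<in> path_image (circlepath 0 r)"
    then have w: "norm w = r" using r0 by simp
    then have w0: "w \<noteq> 0" using r0 by auto
    have tr: "AW_transition c2 s t (w + 1 / w) g =
        1 / ?P * contour_integral (circlepath 0 r') (\<lambda>v. B v / h w v)"
      unfolding B_def h_def
      by (rule AW_transition_eq[OF _ s g at])
        (use c2 r r' w w0 in \<open>auto simp: norm_frak_u_joukowski\<close>)
    have inner: "contour_integral (circlepath 0 r') (\<lambda>v. A w * B v / h w v) =
        A w * contour_integral (circlepath 0 r') (\<lambda>v. B v / h w v)"
      using contour_integral_cmult[of _ "A w" "\<lambda>v. B v / h w v"] by simp
    show "1 / frak_h (of_real (a * s)) (w + 1 / w) * AW_transition c2 s t (w + 1 / w) g *
          ((1 - w\<^sup>2) / (w * (1 - ?c * w)) * layer_gf W (w / of_real s)) =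
        1 / ?P * contour_integral (circlepath 0 r') (\<lambda>v. A w * B v / h w v)"
      unfolding tr inner
      by (simp add: A_def mult_ac)
  qed
  also have "\<dots> = 1 / ?P * (1 / ?P * contour_integral (circlepath 0 r)
      (\<lambda>w. contour_integral (circlepath 0 r') (\<lambda>v. A w * B v / h w v)))"
    unfolding contour_integral_cmult ..
  also have "contour_integral (circlepath 0 r)
      (\<lambda>w. contour_integral (circlepath 0 r') (\<lambda>v. A w * B v / h w v)) =
     contour_integral (circlepath 0 r')
      (\<lambda>v. contour_integral (circlepath 0 r) (\<lambda>w. A w * B v / h w v))"
  proof (rule contour_integral_swap)
    show "continuous_on {0..1} (\<lambda>x. vector_derivative (circlepath 0 r) (at x))"
      "continuous_on {0..1} (\<lambda>x. vector_derivative (circlepath 0 r') (at x))"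
      unfolding vector_derivative_circlepath by (intro continuous_intros)+
  qed (use cont r0 r'0 in auto)
  also have "\<dots> = contour_integral (circlepath 0 r') (\<lambda>v. ?P * (g (v + 1 / v) *
      ((1 - v\<^sup>2) / (v * (1 - of_real (c2 * t) * v)) * layer_gf (layer_step a c2 (a * s\<^sup>2) W) (v / of_real t))))"
  proof (rule contour_integral_eq)
    fix v assume "v \<in> path_image (circlepath 0 r')"
    then have v: "norm v = r'" using r'0 by simp
    have "contour_integral (circlepath 0 r) (\<lambda>w. A w * B v / h w v) =
       B v * contour_integral (circlepath 0 r) (\<lambda>w. A w / h w v)"
      using contour_integral_cmult[of _ "B v" "\<lambda>w. A w / h w v"] by (simp add: mult_ac)
    also have "\<dots> = g (v + 1 / v) * (transition_kernel c2 s t v * contour_integral (circlepath 0 r)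
      (\<lambda>w. (1 - w\<^sup>2) / (w * (1 - of_real (c2 * s) * w)) * layer_gf W (w / of_real s) /
        (frak_h (of_real (a * s)) (w + 1 / w) * frak_h (of_real (s / t) * v) (w + 1 / w))))"
      by (simp add: A_def B_def h_def mult.assoc)
    also have "\<dots> = ?P * (g (v + 1 / v) *
      ((1 - v\<^sup>2) / (v * (1 - of_real (c2 * t) * v)) * layer_gf (layer_step a c2 (a * s\<^sup>2) W) (v / of_real t)))"
      by (subst weighted_functional_inner[OF W a s(1) t c2 b r]) (use r' v in auto)
    finally show "contour_integral (circlepath 0 r) (\<lambda>w. A w * B v / h w v) = ?P * (g (v + 1 / v) *
      ((1 - v\<^sup>2) / (v * (1 - of_real (c2 * t) * v)) * layer_gf (layer_step a c2 (a * s\<^sup>2) W) (v / of_real t)))" .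
  qed
  also have "1 / ?P * (1 / ?P * \<dots>) = weighted_functional c2 t (layer_gf (layer_step a c2 (a * s\<^sup>2) W)) g r'"
    unfolding contour_integral_cmult weighted_functional_def by simp
  finally show ?thesis .
qed

section \<open>First time, last time and induction over the times\<close>

lemma layer_gf_geometric:
  assumes "norm y * c < 1" "0 \<le> c"
  shows "layer_gf (\<lambda>n. c ^ n) y = 1 / (1 - of_real c * y)"
proof -
  have "norm (of_real c * y) < 1" using assms by (simp add: norm_mult mult.commute)
  then show ?thesis
    using suminf_geometric[of "of_real c * y"] by (simp add: layer_gf_def power_mult_distrib)
qed

text \<open>The factor \<open>1 / (1 - (c1 / t) * w)\<close> is the generating function of the
  terminal weights at \<open>w / t\<close>; this starts the induction.\<close>

lemma AW_marginal_eq: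
  assumes "0 < t" "0 < c1" "0 < c2" "g analytic_on ellipse_dom \<rho>" "0 < \<rho>"
    and r: "\<rho> < r" "r < 1" "r * (c2 * t) < 1" "r * c1 < t"
  shows "AW_marginal c1 c2 t g = weighted_functional c2 t (layer_gf (\<lambda>n. c1 ^ n)) g r"
proof -
  have "r < 1 / AW_radius (of_real (c2 * t)) (of_real (c1 / t)) 0"
    using assms by (subst less_inverse_AW_radius_iff) (auto simp: norm_mult norm_divide field_simps)
  then have "AW_marginal c1 c2 t g = AW_integral (of_real (c2 * t)) (of_real (c1 / t)) 0 g r"
    unfolding AW_marginal_def by (rule AW_functional_eq_integral[OF assms(4,5) r(1)])
  also have "\<dots> = weighted_functional c2 t (layer_gf (\<lambda>n. c1 ^ n)) g r"
    unfolding AW_integral_def weighted_functional_def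
  proof (rule arg_cong2[where f = "(*)", OF refl contour_integral_eq])
    fix w assume "w \<in> path_image (circlepath 0 r)"
    then have "norm (w / of_real t) * c1 < 1"
      using assms by (simp add: norm_divide)
    then have L: "layer_gf (\<lambda>n. c1 ^ n) (w / of_real t) = 1 / (1 - of_real (c1 / t) * w)"
      using assms layer_gf_geometric[of "w / of_real t" c1] by simp
    show "g (w + 1 / w) * (1 - w\<^sup>2) * (1 - of_real (c2 * t) * of_real (c1 / t) * 0 * w) /
          (w * (1 - of_real (c2 * t) * w) * (1 - of_real (c1 / t) * w) * (1 - 0 * w)) =
        g (w + 1 / w) * ((1 - w\<^sup>2) / (w * (1 - of_real (c2 * t) * w)) * layer_gf (\<lambda>n. c1 ^ n) (w / of_real t))"
      unfolding L by (simp del: of_real_mult of_real_divide)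
  qed
  finally show ?thesis .
qed

lemma inverse_frak_h_analytic:
  assumes "0 < \<alpha>"
  shows "(\<lambda>y. 1 / frak_h (of_real \<alpha>) y) analytic_on ellipse_dom \<alpha>"
proof -
  have "frak_h (of_real \<alpha>) y \<noteq> 0" if "y \<in> ellipse_dom \<alpha>" for y
    by (rule frak_h_nonzero[OF assms that]) (use assms in simp)
  then show ?thesis unfolding frak_h_def by (intro analytic_intros) auto
qed

text \<open>A single residue at \<open>a * t\<close> produces the tail at state \<open>0\<close>
  divided by \<open>1 - a * t\<^sup>2 * c2\<close>, so the last slot acts as one more transfer step,
  evaluated at state \<open>0\<close>.\<close>

lemma weighted_functional_inverse_frak_h:
  assumes W: "geo_bounded q W" "0 < q" and a: "0 < a" "a * q < 1" and t: "0 < t" and c2: "0 < c2"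
    and r: "a * t < r" "r < 1" "r * (c2 * t) < 1" "r * q < t"
  shows "weighted_functional c2 t (layer_gf W) (\<lambda>y. 1 / frak_h (of_real (a * t)) y) r =
    of_real (layer_step a c2 (a * t\<^sup>2) W 0)"
proof -
  define \<alpha> where "\<alpha> = complex_of_real (a * t)"
  let ?c = "complex_of_real (c2 * t)" and ?F = "layer_gf W"
  have r0: "0 < r" using r(1) a t by (smt (verit) mult_pos_pos)
  have \<alpha>: "norm \<alpha> < r" using r a t by (simp add: \<alpha>_def norm_mult)
  have small: "1 - \<alpha> * w \<noteq> 0" "1 - ?c * w \<noteq> 0" if "norm w \<le> r" for w
  proof -
    have "norm w * norm \<alpha> \<le> r * r" using that r0 \<alpha> by (intro mult_mono) auto
    also have "\<dots> < 1" using r r0 mult_strict_mono[of r 1 r 1] by simp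
    finally show "1 - \<alpha> * w \<noteq> 0" by (rule one_minus_mult_nonzero)
    have "norm w * norm ?c = norm w * (c2 * t)" using c2 t by (simp add: norm_mult)
    also have "\<dots> \<le> r * (c2 * t)" using that c2 t by (intro mult_right_mono) auto
    also note r(3)
    finally show "1 - ?c * w \<noteq> 0" by (rule one_minus_mult_nonzero)
  qed
  \<comment> \<open>The factor \<open>w\<close> from the single \<open>h\<close> cancels the pole of
    the kernel at the origin.\<close>
  define \<phi> where "\<phi> = (\<lambda>w. (1 - w\<^sup>2) * ?F (w / of_real t) / ((1 - \<alpha> * w) * (1 - ?c * w)))"
  have \<phi>: "\<phi> holomorphic_on cball 0 r"
    unfolding \<phi>_def
    by (intro holomorphic_intros layer_gf_rescaled_holomorphic[OF W t r(4)]) (use small in auto)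
  have "weighted_functional c2 t ?F (\<lambda>y. 1 / frak_h \<alpha> y) r =
      1 / (2 * of_real pi * \<i>) * contour_integral (circlepath 0 r) (\<lambda>w. \<phi> w / (w - \<alpha>))"
    unfolding weighted_functional_def
  proof (rule arg_cong2[where f = "(*)", OF refl contour_integral_eq])
    fix w assume "w \<in> path_image (circlepath 0 r)"
    then have w: "norm w = r" using r0 by simp
    then have w0: "w \<noteq> 0" "w - \<alpha> \<noteq> 0" using r0 \<alpha> by auto
    have h: "frak_h \<alpha> (w + 1 / w) = (1 - \<alpha> * w) * (w - \<alpha>) / w"
      unfolding frak_h_joukowski[OF w0(1)] using w0(1) by (simp add: field_simps)
    show "1 / frak_h \<alpha> (w + 1 / w) * ((1 - w\<^sup>2) / (w * (1 - ?c * w)) * ?F (w / of_real t)) = \<phi> w / (w - \<alpha>)"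
      unfolding h \<phi>_def using w0 small[of w] w by (simp add: divide_simps)
  qed
  also have "contour_integral (circlepath 0 r) (\<lambda>w. \<phi> w / (w - \<alpha>)) = 2 * of_real pi * \<i> * \<phi> \<alpha>"
    by (intro contour_integral_unique Cauchy_integral_circlepath)
      (use \<phi> \<alpha> in \<open>auto intro: holomorphic_on_imp_continuous_on holomorphic_on_subset\<close>)
  also have "\<phi> \<alpha> = ?F (of_real a) / (1 - ?c * \<alpha>)"
    using small(1)[of \<alpha>] \<alpha> t unfolding \<phi>_def by (simp add: power2_eq_square \<alpha>_def)
  also have "?F (of_real a) = of_real (geo_tail a W 0)"
    using W a by (intro layer_gf_at_real) auto
  also have "1 - ?c * \<alpha> = of_real (1 - a * t\<^sup>2 * c2)"
    by (simp add: \<alpha>_def power2_eq_square mult_ac)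
  finally show ?thesis by (simp add: \<alpha>_def)
qed

text \<open>The last slot holds an arbitrary analytic function because the recursion of
  \<open>AW_joint\<close> multiplies slot \<open>d\<close> by a transition functional. The radius is
  arbitrary as well, since each time needs its own circle.\<close>

lemma AW_joint_eq_weighted_functional:
  assumes pos: "0 < a" "0 < c1" "0 < c2" and q: "c1 \<le> q" "a * q < 1"
    and t: "\<And>j. 1 \<le> j \<Longrightarrow> j \<le> Suc d \<Longrightarrow> 0 < t j" "\<And>j. 1 \<le> j \<Longrightarrow> j \<le> d \<Longrightarrow> t j \<le> t (Suc j)"
    and b: "\<And>j. 1 \<le> j \<Longrightarrow> j \<le> d \<Longrightarrow> a * (t j)\<^sup>2 < q"
      "\<And>j. 1 \<le> j \<Longrightarrow> j \<le> Suc d \<Longrightarrow> a * (t j)\<^sup>2 * c2 < 1"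
      "\<And>j. 1 \<le> j \<Longrightarrow> j \<le> Suc d \<Longrightarrow> a * t j < 1"
    and f: "f (Suc d) analytic_on ellipse_dom (a * t (Suc d))"
      "\<And>j. 1 \<le> j \<Longrightarrow> j \<le> d \<Longrightarrow> f j = (\<lambda>y. 1 / frak_h (of_real (a * t j)) y)"
    and r: "a * t (Suc d) < r" "r < 1" "r * (c2 * t (Suc d)) < 1" "r * q < t (Suc d)"
  shows "AW_joint c1 c2 t (Suc d) f =
    weighted_functional c2 (t (Suc d)) (layer_gf (layer_weight a c1 c2 t d)) (f (Suc d)) r"
  using t b f r
proof (induction d arbitrary: f r)
  case 0
  have "0 < a * t 1" using 0(1)[of 1] pos by simp
  then have "0 < r" using 0(8) by simp
  then have "r * c1 \<le> r * q" using q by (intro mult_left_mono) auto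
  then have "r * c1 < t 1" using 0 by simp
  then show ?case
    using AW_marginal_eq[OF 0(1)[of 1] pos(2,3), of "f 1" "a * t 1" r] 0 \<open>0 < a * t 1\<close> by simp
next
  case (Suc d)
  let ?s = "t (Suc d)" and ?t = "t (Suc (Suc d))" and ?W = "layer_weight a c1 c2 t d"
  let ?g = "f (Suc (Suc d))"
  have s: "0 < ?s" "?s \<le> ?t" and t0: "0 < ?t" using Suc.prems(1,2) by auto
  have q0: "0 < q" using pos q by simp
  have r0: "0 < r" using Suc.prems(8) pos t0 by (smt (verit) mult_pos_pos)
  \<comment> \<open>The lower bound on the circle at time \<open>?s\<close> imposed by
    \<open>?s * r < ?t * r'\<close>. Relative to \<open>weighted_functional_step\<close> the radii
    \<open>r\<close> and \<open>r'\<close> exchange names.\<close>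
  define u where "u = ?s * r / ?t"
  have "a * ?s < u" using Suc.prems(8) s t0 by (simp add: u_def field_simps)
  have ur: "u \<le> r" using s r0 t0 by (simp add: u_def field_simps mult_right_mono)
  have "u < 1" using ur Suc.prems(9) by simp
  moreover have "u < 1 / (c2 * ?s)"
  proof -
    have "u * (c2 * ?s) \<le> r * (c2 * ?t)"
      using ur s pos r0 by (intro mult_mono) auto
    also have "\<dots> < 1" using Suc.prems(10) by simp
    finally show ?thesis using s pos by (simp add: field_simps)
  qed
  moreover have "u < ?s / q"
    using Suc.prems(11) s t0 q0 by (simp add: u_def field_simps)
  ultimately have "u < min (min 1 (1 / (c2 * ?s))) (?s / q)" by simp
  then obtain r' where r': "u < r'" "r' < 1" "r' < 1 / (c2 * ?s)" "r' < ?s / q"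
    by (meson dense min_less_iff_conj)
  have as: "a * ?s < r'" using r'(1) \<open>a * ?s < u\<close> by linarith
  have r'': "r' * (c2 * ?s) < 1" "r' * q < ?s" "?s * r < ?t * r'"
    using r' s t0 q0 pos by (auto simp: u_def field_simps)
  define g' where "g' = (\<lambda>x. 1 / frak_h (of_real (a * ?s)) x * AW_transition c2 ?s ?t x ?g)"
  let ?f = "f(Suc d := g')"
  have g': "g' analytic_on ellipse_dom (a * ?s)"
    unfolding g'_def
    by (intro analytic_on_mult inverse_frak_h_analytic AW_transition_analytic[OF pos(1) s pos(3)])
      (use Suc.prems(4-6) pos s in auto)
  have "AW_joint c1 c2 t (Suc (Suc d)) f = AW_joint c1 c2 t (Suc d) ?f"
    using Suc.prems(7)[of "Suc d"] by (simp add: g'_def)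
  also have "\<dots> = weighted_functional c2 ?s (layer_gf ?W) (?f (Suc d)) r'"
    by (rule Suc.IH) (use Suc.prems g' r' as r'' in auto)
  also have "\<dots> = weighted_functional c2 ?t (layer_gf (layer_weight a c1 c2 t (Suc d))) ?g r"
  proof -
    have "geo_bounded q ?W"
      by (rule state_term_has_sum(1)[where q = q]) (use pos q Suc.prems in auto)
    then show ?thesis
      unfolding fun_upd_same g'_def layer_weight.simps
      by (intro weighted_functional_step[where q = q] q0 pos q s r' as r'' Suc.prems) auto
  qed
  finally show ?case .
qed

theorem theorem1p4:
  fixes N :: nat and a c1 c2 :: real and t :: "nat \<Rightarrow> real"
  assumes "N \<ge> 1" and "0 < a" and "a < 1" and "c1 > 0" and "c2 > 0" and "a * c1 < 1"
    and "0 < t 1" and "\<And>i j. 1 \<le> i \<Longrightarrow> i \<le> j \<Longrightarrow> j \<le> N \<Longrightarrow> t i \<le> t j"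
    and "a * t N < 1" and "a * (t N)\<^sup>2 * c2 < 1"
  shows "gen_fun_term N a c1 c2 t summable_on increment_pairs N \<and>
    complex_of_real (gen_fun N a c1 c2 t) =
      AW_joint c1 c2 t N (\<lambda>j y. 1 / frak_h (of_real (a * t j)) y)"
proof -
  obtain d where N: "N = Suc d" using assms(1) by (cases N) auto
  have t0: "0 < t j" if "1 \<le> j" "j \<le> N" for j
    using assms(7) assms(8)[of 1 j] that by simp
  have tN: "t j \<le> t N" if "1 \<le> j" "j \<le> N" for j using assms(8) that by simp
  have tN2: "(t j)\<^sup>2 \<le> (t N)\<^sup>2" if "1 \<le> j" "j \<le> N" for j
    using tN[OF that] t0[OF that] by (intro power_mono) auto
  \<comment> \<open>Squaring gives \<open>a * (t N)\<^sup>2 < 1 / a\<close>, which together with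
    \<open>a * c1 < 1\<close> leaves room for the growth rate \<open>q\<close>.\<close>
  have "(a * t N) * (a * t N) < 1"
    using assms(9) t0[of N] assms(1,2) mult_strict_mono[of "a * t N" 1 "a * t N" 1] by simp
  then have "max c1 (a * (t N)\<^sup>2) < 1 / a"
    using assms(2,6) by (simp add: field_simps power2_eq_square)
  then obtain q where q: "max c1 (a * (t N)\<^sup>2) < q" "q < 1 / a" using dense by blast
  have q': "c1 \<le> q" "a * q < 1" "0 < q" "a * (t N)\<^sup>2 < q"
    using q assms(2,4) by (auto simp: field_simps)
  have b1: "a * (t j)\<^sup>2 < q" if "1 \<le> j" "j \<le> N" for j
    using mult_left_mono[OF tN2[OF that], of a] assms(2) q' by linarith
  have b2: "a * (t j)\<^sup>2 * c2 < 1" if "1 \<le> j" "j \<le> N" for j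
    using mult_right_mono[OF mult_left_mono[OF tN2[OF that], of a], of c2] assms(2,5,10) by linarith
  have b3: "a * t j < 1" if "1 \<le> j" "j \<le> N" for j
    using mult_left_mono[OF tN[OF that], of a] assms(2,9) by linarith
  have "(gen_fun_term N a c1 c2 t has_sum layer_weight a c1 c2 t N 0) (increment_pairs N)"
    unfolding gen_fun_term_eq_state_term[OF assms(1)]
    by (rule state_term_has_sum(2)[where q = q]) (use assms q' b1 b2 in auto)
  then have sum: "gen_fun_term N a c1 c2 t summable_on increment_pairs N"
    "gen_fun N a c1 c2 t = layer_weight a c1 c2 t N 0"
    by (auto simp: gen_fun_def infsumI has_sum_imp_summable)
  \<comment> \<open>The last two bounds amount to \<open>a * (t N)\<^sup>2 * c2 < 1\<close> and
    \<open>a * q < 1\<close>.\<close>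
  have "a * t N < min (min 1 (1 / (c2 * t N))) (t N / q)"
    using t0[of N] assms q' by (auto simp: field_simps power2_eq_square)
  then obtain r where r: "a * t N < r" "r < 1" "r < 1 / (c2 * t N)" "r < t N / q"
    by (meson dense min_less_iff_conj)
  have r': "r * (c2 * t N) < 1" "r * q < t N"
    using r t0[of N] assms q' by (auto simp: field_simps)
  let ?f = "\<lambda>j y. 1 / frak_h (of_real (a * t j)) y"
  have "AW_joint c1 c2 t (Suc d) ?f =
      weighted_functional c2 (t (Suc d)) (layer_gf (layer_weight a c1 c2 t d)) (?f (Suc d)) r"
  proof (rule AW_joint_eq_weighted_functional[where q = q])
    show "?f (Suc d) analytic_on ellipse_dom (a * t (Suc d))"
      by (rule inverse_frak_h_analytic) (use assms(2) t0 N in simp)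
  qed (use assms q' b1 b2 b3 t0 r r' N in auto)
  also have "\<dots> = of_real (layer_step a c2 (a * (t (Suc d))\<^sup>2) (layer_weight a c1 c2 t d) 0)"
  proof (rule weighted_functional_inverse_frak_h[where q = q])
    show "geo_bounded q (layer_weight a c1 c2 t d)"
      by (rule state_term_has_sum(1)[where q = q]) (use assms q' b1 b2 N in auto)
  qed (use assms q' t0 r r' N in auto)
  finally show ?thesis using sum by (simp add: N)
qed

end
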